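(* For every integer $n\geq 1$, the Euler characteristic of $Q_n$ is $$\chi(Q_n)=(n-1)!\cdot 2^{1-\frac{n}{2}}\cos\left(\frac{\pi n}{4}\right).$$
   Context: Let $S^1$ be the circle with a fixed point $\infty\in S^1$, let $T^{n-1}=\{(x_1,\ldots,x_{n-1})\mid x_i\in S^1\}$ be the $(n-1)$-dimensional torus and set $x_n=\infty$. For $1\leq i<j<k\leq n$ let $A_{ijk}\subset T^{n-1}$ be the subset of points satisfying $x_i=x_j=x_k$, and let $A_n=\bigcup_{1\leq i<j<k\leq n}A_{ijk}$. The space $Q_n$ is the complement $T^{n-1}\setminus A_n$ (the space of configurations of $n$ ordered points on the circle, no three of which coincide, with the last point fixed at $\infty$). *)

theory Defs
  imports "HOL-Homology.Homology" "HOL-Library.Extended_Nat"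
begin

text \<open>Groups are written multiplicatively in HOL-Algebra, so integral linear combinations
  appear as products of powers.\<close>

definition int_independent :: "('a, 'b) monoid_scheme \<Rightarrow> 'a set \<Rightarrow> bool" where
  "int_independent G S \<longleftrightarrow> finite S \<and> S \<subseteq> carrier G \<and>
     (\<forall>c :: 'a \<Rightarrow> int. finprod G (\<lambda>x. x [^]\<^bsub>G\<^esub> c x) S = \<one>\<^bsub>G\<^esub> \<longrightarrow> (\<forall>x\<in>S. c x = 0))"

definition abelian_rank :: "('a, 'b) monoid_scheme \<Rightarrow> enat" where
  "abelian_rank G = (SUP S\<in>{S. int_independent G S}. enat (card S))"

definition betti :: "nat \<Rightarrow> 'a topology \<Rightarrow> enat" where
  "betti p X = abelian_rank (homology_group (int p) X)"

text \<open>The alternating sum of Betti numbers below is meaningful only for spaces satisfying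
  the following condition.\<close>

definition finite_betti :: "'a topology \<Rightarrow> bool" where
  "finite_betti X \<longleftrightarrow> (\<forall>p. betti p X \<noteq> \<infinity>) \<and> finite {p. betti p X \<noteq> 0}"

definition euler_characteristic :: "'a topology \<Rightarrow> int" where
  "euler_characteristic X = (\<Sum>p | betti p X \<noteq> 0. (-1) ^ p * int (the_enat (betti p X)))"

definition circle :: "complex topology" where
  "circle = top_of_set (sphere 0 1)"

text \<open>Points of the torus are functions on \<open>{1..<n}\<close>, extensional outside of it; for \<open>n = 1\<close>
  this is the one-point space.\<close>

definition torus :: "nat \<Rightarrow> (nat \<Rightarrow> complex) topology" where
  "torus n = product_topology (\<lambda>_. circle) {1..<n}"

text \<open>In the following, \<open>w\<close> is the distinguished point of the circle (called infinity in the
  informal setting), and \<open>x(n := w)\<close> extends a point of the torus by the convention that its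
  \<open>n\<close>-th coordinate is \<open>w\<close>.\<close>

definition triple_coincidence ::
    "nat \<Rightarrow> complex \<Rightarrow> nat \<Rightarrow> nat \<Rightarrow> nat \<Rightarrow> (nat \<Rightarrow> complex) set" where
  "triple_coincidence n w i j k =
     {x \<in> topspace (torus n). (x(n := w)) i = (x(n := w)) j \<and> (x(n := w)) j = (x(n := w)) k}"

definition no_three_equal_space :: "nat \<Rightarrow> complex \<Rightarrow> (nat \<Rightarrow> complex) topology" where
  "no_three_equal_space n w = subtopology (torus n)
     (topspace (torus n) -
       \<Union>{triple_coincidence n w i j k | i j k. 1 \<le> i \<and> i < j \<and> j < k \<and> k \<le> n})"

end

theory Submission
  imports Defs
begin

text \<open>Ranks of abelian groups add up along homomorphisms, so the long exact sequence of a pair and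
  excision give \<open>\<chi>(A \<union> B) = \<chi>(A) + \<chi>(B) - \<chi>(A \<inter> B)\<close> for open \<open>A\<close>, \<open>B\<close>. Let \<open>L n\<close> be the Euler
  characteristic of the space \<open>M n\<close> of \<open>n\<close>-tuples of real numbers with no three equal. Such a tuple has
  a unique minimal coordinate, or two coordinates below all others. The former condition defines \<open>n\<close>
  disjoint open sets homotopy equivalent to \<open>M (n - 1)\<close>, the latter \<open>n choose 2\<close> disjoint open sets
  homotopy equivalent to \<open>M (n - 2)\<close>, and the overlaps are \<open>n (n - 1)\<close> sets homotopy equivalent to
  \<open>M (n - 2)\<close>; hence \<open>L n = n L (n - 1) - (n choose 2) L (n - 2)\<close>.
  On the circle, cover the configuration space by the open set where no coordinate equals \<open>w\<close>, which
  is \<open>M (n - 1)\<close>, and the \<open>n - 1\<close> disjoint open sets where one coordinate is strictly nearest to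
  \<open>w\<close>, each homotopy equivalent to \<open>M (n - 2)\<close>. Each of these meets the first set in two copies of
  \<open>M (n - 2)\<close>, so the Euler characteristic is \<open>L (n - 1) - (n - 1) L (n - 2)\<close>.\<close>

subsection \<open>Rank of abelian groups\<close>

lemma (in group_hom) hom_finprod:
  assumes "comm_group G" "comm_group H" "f \<in> A \<rightarrow> carrier G"
  shows "h (finprod G f A) = finprod H (\<lambda>i. h (f i)) A"
proof -
  interpret G: comm_group G by fact
  interpret H: comm_group H by fact
  show ?thesis
    using assms(3) by (induct A rule: infinite_finite_induct) (auto simp: Pi_def)
qed

lemma (in comm_group) finprod_int_pow:
  fixes k :: int
  assumes "f \<in> A \<rightarrow> carrier G"
  shows "finprod G (\<lambda>i. f i [^] k) A = finprod G f A [^] k"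
  using assms by (induct A rule: infinite_finite_induct) (auto simp: Pi_def int_pow_distrib)

text \<open>Independence is indexed so that an independent set and the lifts of another one can be
  joined along a disjoint sum; \<open>free_family_inj_on\<close> leads back to sets.\<close>

definition free_family :: "('a, 'b) monoid_scheme \<Rightarrow> ('i \<Rightarrow> 'a) \<Rightarrow> 'i set \<Rightarrow> bool" where
  "free_family G f A \<longleftrightarrow> finite A \<and> f \<in> A \<rightarrow> carrier G \<and>
     (\<forall>c :: 'i \<Rightarrow> int. finprod G (\<lambda>i. f i [^]\<^bsub>G\<^esub> c i) A = \<one>\<^bsub>G\<^esub> \<longrightarrow> (\<forall>i\<in>A. c i = 0))"

lemma free_familyD:
  fixes c :: "'i \<Rightarrow> int"
  assumes "free_family G f A" "finprod G (\<lambda>i. f i [^]\<^bsub>G\<^esub> c i) A = \<one>\<^bsub>G\<^esub>" "i \<in> A"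
  shows "c i = 0"
  using assms unfolding free_family_def by blast

lemma free_family_inj_on:
  fixes G (structure)
  assumes "comm_group G" "free_family G f A"
  shows "inj_on f A"
proof (rule inj_onI, rule ccontr)
  interpret comm_group G by fact
  fix a b assume ab: "a \<in> A" "b \<in> A" "f a = f b" "a \<noteq> b"
  have fin: "finite A" and f: "f \<in> A \<rightarrow> carrier G" using assms(2) by (auto simp: free_family_def)
  \<comment> \<open>Written additively, a repeated value gives the nontrivial relation f a - f b =
    0.\<close>
  define c :: "_ \<Rightarrow> int" where "c = (\<lambda>x. if x = a then 1 else if x = b then -1 else 0)"
  have "finprod G (\<lambda>i. f i [^] c i) A = finprod G (\<lambda>i. f i [^] c i) {a, b}"
    using fin f ab by (intro finprod_mono_neutral_cong_right) (auto simp: c_def Pi_iff)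
  also have "\<dots> = f a [^] (1::int) \<otimes> f b [^] (-1::int)"
    using f ab by (subst finprod_insert) (auto simp: c_def Pi_iff)
  also have "\<dots> = \<one>"
    using f ab by (simp add: int_pow_neg Pi_iff)
  finally have "c a = 0" using free_familyD[OF assms(2)] ab by blast
  then show False by (simp add: c_def)
qed

lemma free_family_imp_int_independent:
  fixes G (structure)
  assumes "comm_group G" "free_family G f A"
  shows "int_independent G (f ` A)"
proof -
  interpret comm_group G by fact
  have fin: "finite A" and f: "f \<in> A \<rightarrow> carrier G" using assms(2) by (auto simp: free_family_def)
  have inj: "inj_on f A" using assms by (rule free_family_inj_on)
  show ?thesis unfolding int_independent_def
  proof (intro conjI allI impI ballI)
    fix c :: "_ \<Rightarrow> int" and x
    assume "(\<Otimes>x\<in>f ` A. x [^] c x) = \<one>" "x \<in> f ` A"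
    moreover have "(\<Otimes>x\<in>f ` A. x [^] c x) = (\<Otimes>i\<in>A. f i [^] c (f i))"
      using f by (intro finprod_reindex inj) auto
    ultimately show "c x = 0"
      using free_familyD[OF assms(2), of "\<lambda>i. c (f i)"] by auto
  qed (use fin f in auto)
qed

text \<open>Independence is measured in the ambient group \<open>G\<close>, so kernels and images
  have a rank without being turned into groups of their own.\<close>

definition rank_on :: "('a, 'b) monoid_scheme \<Rightarrow> 'a set \<Rightarrow> enat" where
  "rank_on G H = (SUP S\<in>{S. int_independent G S \<and> S \<subseteq> H}. enat (card S))"

lemma abelian_rank_eq_rank_on: "abelian_rank G = rank_on G (carrier G)"
  unfolding abelian_rank_def rank_on_def
  by (rule arg_cong[where f = "\<lambda>A. Sup (_ ` A)"]) (auto simp: int_independent_def)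

lemma card_le_rank_on:
  assumes "comm_group G" "free_family G f A" "f ` A \<subseteq> H"
  shows "enat (card A) \<le> rank_on G H"
proof -
  have "card A = card (f ` A)"
    using free_family_inj_on[OF assms(1,2)] by (simp add: card_image)
  then show ?thesis
    unfolding rank_on_def using free_family_imp_int_independent[OF assms(1,2)] assms(3)
    by (auto intro!: SUP_upper2[of "f ` A"])
qed

lemma int_independent_empty: "int_independent G {}"
  by (simp add: int_independent_def)

text \<open>If \<open>r\<close> is finite, an element of \<open>A\<close> shows that
  \<open>b\<close> is finite too, so the supremum can be bounded by \<open>r - b\<close>.\<close>

lemma SUP_add_const_le_enat:
  fixes b r :: enat
  assumes "A \<noteq> {}" "\<And>x. x \<in> A \<Longrightarrow> f x + b \<le> r"
  shows "(SUP x\<in>A. f x) + b \<le> r"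
proof (cases r)
  case (enat n)
  from assms obtain x where "f x + b \<le> r" by auto
  then obtain m where m: "b = enat m" "m \<le> n"
    using enat by (cases b; cases "f x") auto
  have "f x \<le> enat (n - m)" if "x \<in> A" for x
    using assms(2)[OF that] m enat by (cases "f x") auto
  then have "(SUP x\<in>A. f x) \<le> enat (n - m)" by (rule SUP_least)
  then have "(SUP x\<in>A. f x) + b \<le> enat (n - m) + b" by (rule add_right_mono)
  also have "\<dots> = r" using m enat by simp
  finally show ?thesis .
qed simp

text \<open>An independent set in the image is lifted along a section of \<open>h\<close> and joined
  to an independent set in the kernel. Applying \<open>h\<close> to a relation leaves only the
  lifted part, so its coefficients vanish first and the remaining ones follow.\<close>

lemma (in group_hom) rank_on_kernel_add_image_le:
  assumes "comm_group G" "comm_group H"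
  shows "rank_on G (kernel G H h) + rank_on H (h ` carrier G) \<le> rank_on G (carrier G)"
proof -
  interpret G: comm_group G by fact
  interpret H: comm_group H by fact
  have main: "enat (card S) + enat (card T) \<le> rank_on G (carrier G)"
    if S: "int_independent G S" "S \<subseteq> kernel G H h"
      and T: "int_independent H T" "T \<subseteq> h ` carrier G" for S T
  proof -
    define g where "g = inv_into (carrier G) h"
    have g: "g t \<in> carrier G" "h (g t) = t" if "t \<in> T" for t
      using that T(2) by (auto simp: g_def inv_into_into f_inv_into_f)
    have TH: "T \<subseteq> carrier H" using T(2) hom_closed by blast
    have hS: "h s = \<one>\<^bsub>H\<^esub>" "s \<in> carrier G" if "s \<in> S" for s
      using that S(2) by (auto simp: kernel_def)
    define f where "f = case_sum (\<lambda>s. s) g"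
    have fin: "finite S" "finite T" using S T by (auto simp: int_independent_def)
    have fc: "f \<in> S <+> T \<rightarrow> carrier G"
      using g hS by (auto simp: f_def)
    have "free_family G f (S <+> T)"
      unfolding free_family_def
    proof (intro conjI allI impI)
      fix c :: "_ \<Rightarrow> int"
      assume 1: "(\<Otimes>i\<in>S <+> T. f i [^] c i) = \<one>"
      have "(\<Otimes>i\<in>S <+> T. f i [^] c i) =
            (\<Otimes>i\<in>Inl ` S. f i [^] c i) \<otimes> (\<Otimes>i\<in>Inr ` T. f i [^] c i)"
        unfolding Plus_def using fin fc by (intro G.finprod_Un_disjoint) auto
      also have "(\<Otimes>i\<in>Inl ` S. f i [^] c i) = (\<Otimes>s\<in>S. s [^] c (Inl s))"
        using hS by (subst G.finprod_reindex) (auto simp: f_def inj_on_def)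
      also have "(\<Otimes>i\<in>Inr ` T. f i [^] c i) = (\<Otimes>t\<in>T. g t [^] c (Inr t))"
        using g by (subst G.finprod_reindex) (auto simp: f_def inj_on_def)
      finally have 2: "(\<Otimes>s\<in>S. s [^] c (Inl s)) \<otimes> (\<Otimes>t\<in>T. g t [^] c (Inr t)) = \<one>"
        using 1 by simp
      have "h (\<Otimes>s\<in>S. s [^] c (Inl s)) = \<one>\<^bsub>H\<^esub>"
        using hS by (subst hom_finprod) (auto simp: assms hom_int_pow intro!: H.finprod_one_eqI)
      moreover have "h (\<Otimes>t\<in>T. g t [^] c (Inr t)) = (\<Otimes>\<^bsub>H\<^esub>t\<in>T. t [^]\<^bsub>H\<^esub> c (Inr t))"
        using g T(2) by (subst hom_finprod) (auto simp: assms hom_int_pow intro!: H.finprod_cong')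
      moreover have "h ((\<Otimes>s\<in>S. s [^] c (Inl s)) \<otimes> (\<Otimes>t\<in>T. g t [^] c (Inr t))) = \<one>\<^bsub>H\<^esub>"
        by (simp add: 2)
      moreover have "(\<Otimes>\<^bsub>H\<^esub>t\<in>T. t [^]\<^bsub>H\<^esub> c (Inr t)) \<in> carrier H"
        using TH by (intro H.finprod_closed) auto
      ultimately have "(\<Otimes>\<^bsub>H\<^esub>t\<in>T. t [^]\<^bsub>H\<^esub> c (Inr t)) = \<one>\<^bsub>H\<^esub>"
        using g hS TH by (subst (asm) hom_mult) (auto simp: Pi_iff subset_iff intro!: H.l_one H.finprod_closed G.finprod_closed)
      then have cT: "\<forall>t\<in>T. c (Inr t) = 0"
        using T(1) unfolding int_independent_def by (auto dest: spec[of _ "\<lambda>t. c (Inr t)"])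
      then have "(\<Otimes>t\<in>T. g t [^] c (Inr t)) = \<one>"
        by (intro G.finprod_one_eqI) auto
      with 2 have "(\<Otimes>s\<in>S. s [^] c (Inl s)) = \<one>"
        using hS by (auto intro!: G.finprod_closed)
      then have "\<forall>s\<in>S. c (Inl s) = 0"
        using S(1) unfolding int_independent_def by (auto dest: spec[of _ "\<lambda>t. c (Inl t)"])
      with cT show "\<forall>i\<in>S <+> T. c i = 0" by auto
    qed (use fin fc in auto)
    then have "enat (card (S <+> T)) \<le> rank_on G (carrier G)"
      using fc by (intro card_le_rank_on[OF assms(1)]) auto
    then show ?thesis using fin by (simp add: card_Plus)
  qed
  have "rank_on H (h ` carrier G) + enat (card S) \<le> rank_on G (carrier G)"
    if "int_independent G S" "S \<subseteq> kernel G H h" for S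
    unfolding rank_on_def[of H] using main[OF that] int_independent_empty[of H]
    by (intro SUP_add_const_le_enat) (auto simp: add.commute)
  then show ?thesis
    unfolding rank_on_def[of G "kernel G H h"] using int_independent_empty[of G]
    by (intro SUP_add_const_le_enat) (auto simp: add.commute)
qed

text \<open>A subset of an independent set that is maximal with independent image splits the set: every other
  element has a nonzero multiple that differs from an element of the kernel by a combination of the subset.\<close>

lemma (in group_hom) rank_on_le_kernel_add_image:
  assumes "comm_group G" "comm_group H"
  shows "rank_on G (carrier G) \<le> rank_on G (kernel G H h) + rank_on H (h ` carrier G)"
  unfolding rank_on_def[of G "carrier G"]
proof (rule SUP_least)
  interpret G: comm_group G by fact
  interpret H: comm_group H by fact
  fix S assume "S \<in> {S. int_independent G S \<and> S \<subseteq> carrier G}"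
  then have S: "int_independent G S" "finite S" "S \<subseteq> carrier G"
    by (auto simp: int_independent_def)
  define P where "P = (\<lambda>T. T \<subseteq> S \<and> free_family H h T)"
  have "finite (Collect P)" unfolding P_def using S(2) by simp
  moreover have "{} \<in> Collect P" by (simp add: P_def free_family_def)
  ultimately obtain T where T: "P T" and Tmax: "\<And>U. P U \<Longrightarrow> T \<subseteq> U \<Longrightarrow> U = T"
    using finite_has_maximal[of "Collect P"] by (metis empty_iff mem_Collect_eq)
  have TS: "T \<subseteq> S" "finite T" and Tf: "free_family H h T" using T S(2)
    by (auto simp: P_def finite_subset)
  have hS: "h x \<in> carrier H" if "x \<in> S" for x using that S(3) hom_closed by blast
  have Sc: "x \<in> carrier G" if "x \<in> S" for x using that S(3) by blast
  have Tc: "x \<in> carrier G" if "x \<in> T" for x using that TS Sc by blast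
  have ex: "\<exists>c :: 'a \<Rightarrow> int. c s \<noteq> 0 \<and> (\<Otimes>x\<in>insert s T. x [^] c x) \<in> kernel G H h" if "s \<in> S - T" for s
  proof -
    have "\<not> free_family H h (insert s T)"
      using Tmax[of "insert s T"] that TS by (auto simp: P_def)
    moreover have "h \<in> insert s T \<rightarrow> carrier H" "finite (insert s T)"
      using that TS hS by auto
    ultimately obtain c :: "'a \<Rightarrow> int" where c: "(\<Otimes>\<^bsub>H\<^esub>x\<in>insert s T. h x [^]\<^bsub>H\<^esub> c x) = \<one>\<^bsub>H\<^esub>"
      "\<exists>x\<in>insert s T. c x \<noteq> 0"
      unfolding free_family_def by blast
    \<comment> \<open>Otherwise a nontrivial relation would hold among the images of
      \<open>T\<close> alone.\<close>
    have "c s \<noteq> 0"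
    proof
      assume "c s = 0"
      moreover have "(\<Otimes>\<^bsub>H\<^esub>x\<in>T. h x [^]\<^bsub>H\<^esub> c x) \<in> carrier H"
        using TS hS by (intro H.finprod_closed) auto
      ultimately have "(\<Otimes>\<^bsub>H\<^esub>x\<in>T. h x [^]\<^bsub>H\<^esub> c x) = \<one>\<^bsub>H\<^esub>"
        using c(1) that TS hS by (subst (asm) H.finprod_insert) auto
      then have "\<forall>x\<in>T. c x = 0" using free_familyD[OF Tf, of c] by auto
      with c(2) \<open>c s = 0\<close> show False by auto
    qed
    moreover have "h (\<Otimes>x\<in>insert s T. x [^] c x) = \<one>\<^bsub>H\<^esub>"
    proof -
      have "h (\<Otimes>x\<in>insert s T. x [^] c x) = (\<Otimes>\<^bsub>H\<^esub>x\<in>insert s T. h (x [^] c x))"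
        using that Sc Tc by (intro hom_finprod assms) auto
      also have "\<dots> = (\<Otimes>\<^bsub>H\<^esub>x\<in>insert s T. h x [^]\<^bsub>H\<^esub> c x)"
        using that Sc Tc hom_int_pow by (intro H.finprod_cong') auto
      finally show ?thesis using c(1) by simp
    qed
    ultimately show ?thesis using that TS(2) S(2) Sc Tc
      by (intro exI[of _ c]) (auto simp: kernel_def intro!: G.finprod_closed)
  qed
  then obtain c :: "'a \<Rightarrow> 'a \<Rightarrow> int"
    where c: "\<And>s. s \<in> S - T \<Longrightarrow> c s s \<noteq> 0"
      "\<And>s. s \<in> S - T \<Longrightarrow> (\<Otimes>x\<in>insert s T. x [^] c s x) \<in> kernel G H h"
    by metis
  define k where "k = (\<lambda>s. \<Otimes>x\<in>insert s T. x [^] c s x)"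
  have kc: "k s \<in> carrier G" if "s \<in> S - T" for s
    using c(2)[OF that] by (simp add: k_def kernel_def)
  have k: "k s = s [^] c s s \<otimes> (\<Otimes>x\<in>T. x [^] c s x)" if "s \<in> S - T" for s
    using that TS(2) S(2) Sc Tc  by (auto simp: k_def intro!: G.finprod_insert)
  \<comment> \<open>Additively this exchanges a double sum: the coefficient of \<open>x\<close>
    collects the contributions of all \<open>s\<close>.\<close>
  have swap: "(\<Otimes>s\<in>A. (\<Otimes>x\<in>T. x [^] (c s x * d s))) = (\<Otimes>x\<in>T. x [^] (\<Sum>s\<in>A. c s x * d s))"
    if "finite A" for A and d :: "'a \<Rightarrow> int"
    using that
  proof (induct A rule: finite_induct)
    case (insert s A)
    have "(\<Otimes>s\<in>insert s A. (\<Otimes>x\<in>T. x [^] (c s x * d s))) =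
       (\<Otimes>x\<in>T. x [^] (c s x * d s)) \<otimes> (\<Otimes>s\<in>A. (\<Otimes>x\<in>T. x [^] (c s x * d s)))"
      using insert TS(2) Sc Tc  by (intro G.finprod_insert) (auto intro!: G.finprod_closed)
    also have "\<dots> = (\<Otimes>x\<in>T. x [^] (c s x * d s) \<otimes> x [^] (\<Sum>s\<in>A. c s x * d s))"
      using insert TS(2) Sc Tc  by (subst G.finprod_multf) auto
    also have "\<dots> = (\<Otimes>x\<in>T. x [^] (\<Sum>s\<in>insert s A. c s x * d s))"
      using insert TS(2) Sc Tc  by (intro G.finprod_cong') (auto simp: G.int_pow_mult)
    finally show ?case .
  qed simp
  have "free_family G k (S - T)"
    unfolding free_family_def
  proof (intro conjI allI impI)
    fix d :: "'a \<Rightarrow> int"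
    assume 1: "(\<Otimes>s\<in>S - T. k s [^] d s) = \<one>"
    \<comment> \<open>\<open>e\<close> holds the coefficients of the relation among the
      \<open>k s\<close>, expanded in the elements of \<open>S\<close>. Outside \<open>T\<close> the
      coefficient of \<open>s\<close> is \<open>d s\<close> times the nonzero \<open>c s s\<close>,
      so independence of \<open>S\<close> forces \<open>d s = 0\<close>.\<close>
    define e where "e = (\<lambda>x. if x \<in> T then \<Sum>s\<in>S - T. c s x * d s else c x x * d x)"
    have "(\<Otimes>s\<in>S - T. k s [^] d s) =
        (\<Otimes>s\<in>S - T. s [^] (c s s * d s) \<otimes> (\<Otimes>x\<in>T. x [^] (c s x * d s)))"
    proof (intro G.finprod_cong')
      fix s assume s: "s \<in> S - T"
      have "k s [^] d s = (s [^] c s s) [^] d s \<otimes> (\<Otimes>x\<in>T. x [^] c s x) [^] d s"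
        using s TS(2) Sc Tc  by (subst k, simp, subst G.int_pow_distrib) (auto intro!: G.finprod_closed)
      also have "(\<Otimes>x\<in>T. x [^] c s x) [^] d s = (\<Otimes>x\<in>T. (x [^] c s x) [^] d s)"
        using TS(2) S(2) Sc Tc  by (subst G.finprod_int_pow) auto
      also have "\<dots> = (\<Otimes>x\<in>T. x [^] (c s x * d s))"
        using TS(2) S(2) Sc Tc  by (intro G.finprod_cong') (auto simp: G.int_pow_pow)
      also have "(s [^] c s s) [^] d s = s [^] (c s s * d s)"
        using s Sc by (auto simp: G.int_pow_pow)
      finally show "k s [^] d s = s [^] (c s s * d s) \<otimes> (\<Otimes>x\<in>T. x [^] (c s x * d s))" .
    qed (use TS(2) S(2) Sc Tc  in \<open>auto intro!: G.finprod_closed\<close>)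
    also have "\<dots> = (\<Otimes>s\<in>S - T. s [^] (c s s * d s)) \<otimes> (\<Otimes>s\<in>S - T. \<Otimes>x\<in>T. x [^] (c s x * d s))"
      using TS(2) S(2) Sc Tc  by (subst G.finprod_multf) (auto intro!: G.finprod_closed)
    also have "\<dots> = (\<Otimes>s\<in>S - T. s [^] e s) \<otimes> (\<Otimes>s\<in>T. s [^] e s)"
    proof -
      have "(\<Otimes>s\<in>S - T. s [^] (c s s * d s)) = (\<Otimes>s\<in>S - T. s [^] e s)"
        "(\<Otimes>x\<in>T. x [^] (\<Sum>s\<in>S - T. c s x * d s)) = (\<Otimes>s\<in>T. s [^] e s)"
        using Sc Tc by (auto intro!: G.finprod_cong' simp: e_def)
      then show ?thesis using S(2) by (simp add: swap)
    qed
    also have "\<dots> = (\<Otimes>s\<in>(S - T) \<union> T. s [^] e s)"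
      using TS(2) S(2) Sc Tc by (intro G.finprod_Un_disjoint[symmetric]) auto
    also have "(S - T) \<union> T = S" using TS by auto
    finally have "\<forall>s\<in>S. e s = 0" using 1 S(1) by (simp add: int_independent_def)
    then show "\<forall>s\<in>S - T. d s = 0" using c(1) by (force simp: e_def split: if_splits)
  qed (use S kc in auto)
  then have "enat (card (S - T)) \<le> rank_on G (kernel G H h)"
    using c(2) by (intro card_le_rank_on[OF assms(1)]) (auto simp: k_def)
  moreover have "enat (card T) \<le> rank_on H (h ` carrier G)"
    using TS(2) S(2) Sc Tc  by (intro card_le_rank_on[OF assms(2) Tf]) auto
  ultimately have "enat (card (S - T)) + enat (card T) \<le> rank_on G (kernel G H h) + rank_on H (h ` carrier G)"
    by (rule add_mono)
  moreover have "card S = card (S - T) + card T"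
    using TS S(2) by (simp add: card_Diff_subset card_mono)
  ultimately show "enat (card S) \<le> rank_on G (kernel G H h) + rank_on H (h ` carrier G)" by simp
qed

lemma rank_on_hom:
  assumes "comm_group G" "comm_group H" "h \<in> hom G H"
  shows "rank_on G (carrier G) = rank_on G (kernel G H h) + rank_on H (h ` carrier G)"
proof -
  interpret group_hom G H h
    using assms by (simp add: group_hom_def group_hom_axioms_def comm_group.axioms)
  show ?thesis
    using rank_on_kernel_add_image_le[OF assms(1,2)] rank_on_le_kernel_add_image[OF assms(1,2)]
    by (rule antisym[OF _ _, rotated])
qed

section \<open>Ranks of trivial, isomorphic and infinite cyclic groups\<close>

lemma rank_on_one:
  fixes G (structure)
  assumes "comm_group G" shows "rank_on G {\<one>} = 0"
proof -
  interpret comm_group G by fact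
  have "enat (card S) \<le> 0" if "int_independent G S" "S \<subseteq> {\<one>}" for S
  proof -
    have "finprod G (\<lambda>x. x [^] (1::int)) S = \<one>"
      using that(2) by (intro finprod_one_eqI) auto
    then have "\<forall>x\<in>S. (1::int) = 0"
      using that(1) unfolding int_independent_def by (auto dest: spec[of _ "\<lambda>_. 1"])
    then have "S = {}" by auto
    then show ?thesis by (simp add: zero_enat_def)
  qed
  then have "rank_on G {\<one>} \<le> 0" unfolding rank_on_def by (intro SUP_least) auto
  then show ?thesis by simp
qed

lemma abelian_rank_trivial:
  assumes "comm_group G" "trivial_group G" shows "abelian_rank G = 0"
  using assms rank_on_one[OF assms(1)] by (simp add: abelian_rank_eq_rank_on trivial_group_def)

lemma abelian_rank_iso:
  assumes "comm_group G" "comm_group H" "G \<cong> H"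
  shows "abelian_rank G = abelian_rank H"
proof -
  from assms(3) obtain h where h: "h \<in> iso G H" by (auto simp: is_iso_def)
  interpret group_hom G H h
    using assms h by (simp add: group_hom_def group_hom_axioms_def comm_group.axioms iso_def)
  have "kernel G H h = {\<one>\<^bsub>G\<^esub>}"
    using h inj_iff_trivial_ker[symmetric] by (auto simp: iso_def bij_betw_def)
  moreover have "h ` carrier G = carrier H" using h by (auto simp: iso_def bij_betw_def)
  ultimately show ?thesis
    using rank_on_hom[OF assms(1,2), of h] h rank_on_one[OF assms(1)]
    by (simp add: abelian_rank_eq_rank_on iso_def)
qed

lemma abelian_rank_integer_group: "abelian_rank integer_group = 1"
proof (rule antisym)
  interpret comm_group integer_group by (rule abelian_integer_group)
  show "abelian_rank integer_group \<le> 1"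
    unfolding abelian_rank_def
  proof (rule SUP_least)
    fix S assume "S \<in> {S. int_independent integer_group S}"
    then have S: "int_independent integer_group S" "finite S" by (auto simp: int_independent_def)
    have "card S \<le> 1"
    proof (rule ccontr)
      assume "\<not> card S \<le> 1"
      then obtain a b where ab: "a \<in> S" "b \<in> S" "a \<noteq> b"
        by (metis One_nat_def S(2) card_le_Suc0_iff_eq)
      have ind: "c x = 0" if "x \<in> S" "finprod integer_group (\<lambda>x. c x * x) S = 0" for c :: "int \<Rightarrow> int" and x
        using S(1) that unfolding int_independent_def by auto
      have fp: "finprod integer_group (\<lambda>x. c x * x) S = c a * a + c b * b"
        if "\<And>x. x \<noteq> a \<Longrightarrow> x \<noteq> b \<Longrightarrow> c x = 0" for c :: "int \<Rightarrow> int"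
      proof -
        have "finprod integer_group (\<lambda>x. c x * x) S = finprod integer_group (\<lambda>x. c x * x) {a, b}"
          using that ab S(2) by (intro finprod_mono_neutral_cong_right) auto
        also have "\<dots> = c a * a + c b * b"
          using ab by (subst finprod_insert) auto
        finally show ?thesis .
      qed
      \<comment> \<open>The relation b * a - a * b = 0 has a nonzero coefficient because
        \<open>a\<close> and \<open>b\<close> are distinct.\<close>
      define c where "c = (\<lambda>x. if x = a then b else if x = b then -a else 0)"
      have "finprod integer_group (\<lambda>x. c x * x) S = 0"
        by (subst fp) (use ab in \<open>auto simp: c_def\<close>)
      then have "c a = 0" "c b = 0"
        using ind[of a c] ind[of b c] ab by auto
      then show False using ab by (auto simp: c_def split: if_splits)
    qed
    then show "enat (card S) \<le> 1" by (simp add: one_enat_def)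
  qed
  have "free_family integer_group (\<lambda>_. 1) {()}"
    by (simp add: free_family_def)
  from card_le_rank_on[OF abelian_integer_group this, of UNIV]
  show "1 \<le> abelian_rank integer_group"
    by (simp add: abelian_rank_eq_rank_on one_enat_def)
qed

subsection \<open>Additivity of the Euler characteristic\<close>

text \<open>This and \<open>alt_sum\<close> are stated for sequences, not spaces, because they are
  also applied to ranks of relative homology groups and of images in a long exact sequence.\<close>

definition finite_seq :: "(nat \<Rightarrow> enat) \<Rightarrow> bool" where
  "finite_seq b \<longleftrightarrow> (\<forall>p. b p \<noteq> \<infinity>) \<and> finite {p. b p \<noteq> 0}"

definition alt_sum :: "(nat \<Rightarrow> enat) \<Rightarrow> int" where
  "alt_sum b = (\<Sum>p | b p \<noteq> 0. (-1) ^ p * int (the_enat (b p)))"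

lemma alt_sum_eq_lessThan:
  assumes "{p. b p \<noteq> 0} \<subseteq> {..<N}"
  shows "alt_sum b = (\<Sum>p<N. (-1) ^ p * int (the_enat (b p)))"
  unfolding alt_sum_def using assms by (intro sum.mono_neutral_left) (auto simp: zero_enat_def)

lemma finite_seq_add_iff: "finite_seq (\<lambda>p. a p + b p) \<longleftrightarrow> finite_seq a \<and> finite_seq b"
proof -
  have "{p. a p + b p \<noteq> 0} = {p. a p \<noteq> 0} \<union> {p. b p \<noteq> 0}" by auto
  then show ?thesis
    by (auto simp: finite_seq_def plus_eq_infty_iff_enat)
qed

lemma finite_seq_Suc_iff:
  assumes "b 0 = 0"
  shows "finite_seq (\<lambda>p. b (Suc p)) \<longleftrightarrow> finite_seq b"
proof -
  have "{p. b p \<noteq> 0} = Suc ` {p. b (Suc p) \<noteq> 0}"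
    using assms by (auto simp: image_iff) (metis not0_implies_Suc)
  moreover have "(\<forall>p. b p \<noteq> \<infinity>) \<longleftrightarrow> (\<forall>p. b (Suc p) \<noteq> \<infinity>)"
    using assms by (metis infinity_ne_i0 not0_implies_Suc)
  ultimately show ?thesis
    by (simp add: finite_seq_def finite_image_iff)
qed

lemma finite_seq_bounded:
  assumes "finite_seq b" obtains N where "{p. b p \<noteq> 0} \<subseteq> {..<N}"
  using assms finite_nat_iff_bounded[of "{p. b p \<noteq> 0}"] by (auto simp: finite_seq_def)

lemma alt_sum_add:
  assumes "finite_seq a" "finite_seq b"
  shows "alt_sum (\<lambda>p. a p + b p) = alt_sum a + alt_sum b"
proof -
  obtain M N where "{p. a p \<noteq> 0} \<subseteq> {..<M}" "{p. b p \<noteq> 0} \<subseteq> {..<N}"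
    using assms by (auto elim!: finite_seq_bounded)
  then have *: "{p. a p \<noteq> 0} \<subseteq> {..<max M N}" "{p. b p \<noteq> 0} \<subseteq> {..<max M N}"
    "{p. a p + b p \<noteq> 0} \<subseteq> {..<max M N}" by fastforce+
  have "the_enat (a p + b p) = the_enat (a p) + the_enat (b p)" for p
    using assms[unfolded finite_seq_def, THEN conjunct1, rule_format, of p]
    by (cases "a p"; cases "b p") auto
  then show ?thesis
    by (simp add: *[THEN alt_sum_eq_lessThan] algebra_simps sum.distrib)
qed

lemma alt_sum_Suc:
  assumes "finite_seq b" "b 0 = 0"
  shows "alt_sum (\<lambda>p. b (Suc p)) = - alt_sum b"
proof -
  obtain N where N: "{p. b p \<noteq> 0} \<subseteq> {..<N}"
    using assms(1) by (rule finite_seq_bounded)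
  then have *: "{p. b p \<noteq> 0} \<subseteq> {..<Suc N}" "{p. b (Suc p) \<noteq> 0} \<subseteq> {..<N}" by auto
  show ?thesis
    unfolding *[THEN alt_sum_eq_lessThan]
    by (subst sum.lessThan_Suc_shift) (simp add: assms(2) zero_enat_def sum_negf)
qed

text \<open>The value is bundled with finiteness, without which the alternating sum carries no
  meaning.\<close>

definition has_euler :: "'a topology \<Rightarrow> int \<Rightarrow> bool" where
  "has_euler X c \<longleftrightarrow> finite_betti X \<and> euler_characteristic X = c"

lemma has_euler_iff: "has_euler X c \<longleftrightarrow> finite_seq (\<lambda>p. betti p X) \<and> alt_sum (\<lambda>p. betti p X) = c"
  by (simp add: has_euler_def finite_betti_def finite_seq_def alt_sum_def euler_characteristic_def)

text \<open>\<open>i\<close>, \<open>j\<close> and \<open>k\<close> are the ranks of the images of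
  the three maps of the long exact sequence. By exactness each kernel is the preceding image, so
  each group splits into two of these ranks. The boundary map lowers the degree, whence
  \<open>k (Suc p)\<close> in degree \<open>p\<close>.\<close>

lemma long_exact_sequence_ranks:
  obtains i j k :: "nat \<Rightarrow> enat" where
    "\<And>p. betti p (subtopology X S) = i p + k (Suc p)"
    "\<And>p. betti p X = i p + j p"
    "\<And>p. abelian_rank (relative_homology_group (int p) X S) = j p + k p"
    "k 0 = 0"
proof
  let ?A = "\<lambda>p. homology_group p (subtopology X S)"
  let ?B = "\<lambda>p. homology_group p X"
  let ?C = "\<lambda>p. relative_homology_group p X S"
  let ?f = "\<lambda>p. hom_induced p (subtopology X S) {} X {} id"
  let ?g = "\<lambda>p. hom_induced p X {} X S id"
  let ?d = "\<lambda>p. hom_boundary p X S"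
  define i where "i = (\<lambda>p. rank_on (?B (int p)) (?f (int p) ` carrier (?A (int p))))"
  define j where "j = (\<lambda>p. rank_on (?C (int p)) (?g (int p) ` carrier (?B (int p))))"
  define k where "k = (\<lambda>p. rank_on (?A (int p - 1)) (?d (int p) ` carrier (?C (int p))))"
  have f: "?f p \<in> hom (?A p) (?B p)" and g: "?g p \<in> hom (?B p) (?C p)"
    and d: "?d p \<in> hom (?C p) (?A (p - 1))" for p
    by (simp_all add: hom_induced_hom hom_boundary_hom)
  have kf: "kernel (?A (p - 1)) (?B (p - 1)) (?f (p - 1)) = ?d p ` carrier (?C p)" for p
    using homology_exactness_axiom_2[of p X S] by simp
  have kg: "kernel (?B p) (?C p) (?g p) = ?f p ` carrier (?A p)" for p
    using homology_exactness_axiom_3[of p X S] by simp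
  have kd: "kernel (?C p) (?A (p - 1)) (?d p) = ?g p ` carrier (?B p)" for p
    using homology_exactness_axiom_1[of p X S] by simp
  show "betti p (subtopology X S) = i p + k (Suc p)" for p
    using rank_on_hom[OF _ _ f[of "int p"]] kf[of "int (Suc p)"]
    by (simp add: betti_def abelian_rank_eq_rank_on abelian_homology_group i_def k_def add.commute)
  show "betti p X = i p + j p" for p
    using rank_on_hom[OF _ _ g[of "int p"]] kg[of "int p"]
    by (simp add: betti_def abelian_rank_eq_rank_on abelian_homology_group i_def j_def)
  show "abelian_rank (?C (int p)) = j p + k p" for p
    using rank_on_hom[OF _ _ d[of "int p"]] kd[of "int p"]
    by (simp add: abelian_rank_eq_rank_on abelian_homology_group j_def k_def)
  \<comment> \<open>In degree 0 the boundary map lands in the homology of degree -1, which is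
    trivial.\<close>
  have "trivial_group (?A (-1))" by simp
  then have "carrier (?A (-1)) = {\<one>\<^bsub>?A (-1)\<^esub>}" by (simp only: trivial_group_def)
  moreover have "?d 0 ` carrier (?C 0) \<subseteq> carrier (?A (-1))"
    using d[of 0] by (auto simp: hom_def)
  moreover have "?d 0 ` carrier (?C 0) \<noteq> {}"
    by (simp add: group.is_monoid monoid.carrier_not_empty)
  ultimately have "?d 0 ` carrier (?C 0) = {\<one>\<^bsub>?A (-1)\<^esub>}" by (metis subset_singletonD)
  then show "k 0 = 0"
    by (simp add: k_def rank_on_one abelian_homology_group)
qed

text \<open>The ranks \<open>k\<close> enter with a shift by one degree and therefore cancel in the
  alternating sum. Finiteness of \<open>a\<close> bounds \<open>i\<close> and \<open>k\<close>, and
  either of the other two sequences bounds \<open>j\<close>; the disjunction lets the lemma be used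
  in both directions in \<open>has_euler_open_Un\<close>.\<close>

lemma long_exact_sequence_euler:
  fixes X :: "'a topology" and S :: "'a set"
  defines "a \<equiv> (\<lambda>p. betti p (subtopology X S))" and "b \<equiv> (\<lambda>p. betti p X)"
    and "c \<equiv> (\<lambda>p. abelian_rank (relative_homology_group (int p) X S))"
  assumes "finite_seq a" "finite_seq b \<or> finite_seq c"
  shows "finite_seq b" "finite_seq c" "alt_sum b = alt_sum a + alt_sum c"
proof -
  obtain i j k where *: "\<And>p. a p = i p + k (Suc p)" "\<And>p. b p = i p + j p" "\<And>p. c p = j p + k p" "k 0 = 0"
    using long_exact_sequence_ranks[of X S] unfolding a_def b_def c_def by metis
  then have eq: "a = (\<lambda>p. i p + k (Suc p))" "b = (\<lambda>p. i p + j p)" "c = (\<lambda>p. j p + k p)" by auto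
  have fin: "finite_seq i" "finite_seq j" "finite_seq k"
    using assms(4,5) finite_seq_Suc_iff[of k] *(4) by (auto simp: eq finite_seq_add_iff)
  then show "finite_seq b" "finite_seq c" by (auto simp: eq finite_seq_add_iff)
  show "alt_sum b = alt_sum a + alt_sum c"
    using fin finite_seq_Suc_iff[of k] alt_sum_add[of i "\<lambda>p. k (Suc p)"] alt_sum_add[of i j]
      alt_sum_add[of j k] alt_sum_Suc[of k] *(4)
    unfolding eq by simp
qed

text \<open>Excising \<open>A - B\<close> from the pair of \<open>A \<union> B\<close> and
  \<open>A\<close> leaves the pair of \<open>B\<close> and \<open>A \<inter> B\<close>, so the two
  long exact sequences share their relative groups. Excision applies because \<open>A - B\<close> is
  closed in the union, its complement being \<open>B\<close>, and lies in the open set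
  \<open>A\<close>.\<close>

lemma has_euler_open_Un:
  assumes A: "openin X A" and B: "openin X B"
    and "has_euler (subtopology X A) a" "has_euler (subtopology X B) b"
      "has_euler (subtopology X (A \<inter> B)) c"
  shows "has_euler (subtopology X (A \<union> B)) (a + b - c)"
proof -
  define Y where "Y = subtopology X (A \<union> B)"
  have sub: "A \<subseteq> topspace X" "B \<subseteq> topspace X" using A B openin_subset by auto
  have tY: "topspace Y = A \<union> B" using sub by (auto simp: Y_def)
  have oA: "openin Y A" and oB: "openin Y B" using A B by (auto simp: Y_def openin_subtopology)
  have YA: "subtopology Y A = subtopology X A" "subtopology Y B = subtopology X B"
    "subtopology Y (A \<inter> B) = subtopology X (A \<inter> B)"
    unfolding Y_def subtopology_subtopology by (rule arg_cong[of _ _ "subtopology X"], blast)+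
  let ?U = "A - B"
  have "closedin Y ?U"
    using closedin_diff[OF closedin_topspace oB] tY by (simp add: Un_Diff)
  moreover have "Y interior_of A = A" using oA by (simp add: interior_of_openin)
  ultimately have ex: "Y closure_of ?U \<subseteq> Y interior_of A" by (simp add: closure_of_closedin)
  have "(A \<union> B) - ?U = B" "A - ?U = A \<inter> B" by auto
  then have iso: "relative_homology_group p (subtopology X B) (A \<inter> B) \<cong> relative_homology_group p Y A" for p
    using homology_excision_axiom[OF ex, of "A \<union> B" p] YA tY unfolding is_iso_def
    by (auto simp: subtopology_topspace[of Y, unfolded tY])
  then have c: "(\<lambda>p. abelian_rank (relative_homology_group (int p) (subtopology X B) (A \<inter> B)))
     = (\<lambda>p. abelian_rank (relative_homology_group (int p) Y A))"
    by (intro ext abelian_rank_iso) auto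
  have "subtopology (subtopology X B) (A \<inter> B) = subtopology X (A \<inter> B)"
    by (simp add: subtopology_subtopology Int_absorb1)
  then have 1: "finite_seq (\<lambda>p. abelian_rank (relative_homology_group (int p) Y A))"
    "b = c + alt_sum (\<lambda>p. abelian_rank (relative_homology_group (int p) Y A))"
    using long_exact_sequence_euler[of "subtopology X B" "A \<inter> B"] assms(4,5)
    by (auto simp: c has_euler_iff)
  show ?thesis
    using long_exact_sequence_euler[of Y A] assms(3) 1
    by (auto simp: has_euler_iff YA Y_def[symmetric])
qed

section \<open>Homotopy invariance, basic spaces and disjoint unions\<close>

lemma has_euler_homotopy_equivalent:
  assumes "X homotopy_equivalent_space Y" "has_euler X c"
  shows "has_euler Y c"
proof -
  have "betti p X = betti p Y" for p
    unfolding betti_def using assms(1)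
    by (intro abelian_rank_iso homotopy_equivalent_space_imp_isomorphic_homology_groups abelian_homology_group)
  then show ?thesis using assms(2) by (simp add: has_euler_iff)
qed

lemma has_euler_empty:
  assumes "topspace X = {}" shows "has_euler X 0"
proof -
  have "betti p X = 0" for p
    unfolding betti_def using assms
    by (intro abelian_rank_trivial abelian_homology_group trivial_homology_group_empty)
  then show ?thesis by (simp add: has_euler_iff finite_seq_def alt_sum_def)
qed

lemma has_euler_singleton:
  assumes "topspace X = {a}"
  shows "has_euler X 1"
proof -
  have 0: "betti 0 X = 1"
    using abelian_rank_iso[OF abelian_homology_group abelian_integer_group homology_coefficients[OF assms]]
    by (simp add: betti_def abelian_rank_integer_group)
  have "betti p X = 0" if "p \<noteq> 0" for p
    unfolding betti_def using that assms
    by (intro abelian_rank_trivial abelian_homology_group homology_dimension_axiom) auto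
  then have *: "betti p X = (if p = 0 then 1 else 0)" for p using 0 by simp
  have "{p. betti p X \<noteq> 0} = {0}" by (auto simp: *)
  then show ?thesis
    by (auto simp: has_euler_iff finite_seq_def alt_sum_def * one_enat_def zero_enat_def)
qed

lemma has_euler_disjoint_UN:
  assumes "finite I" "\<And>i. i \<in> I \<Longrightarrow> openin X (U i)"
    "\<And>i j. i \<in> I \<Longrightarrow> j \<in> I \<Longrightarrow> i \<noteq> j \<Longrightarrow> U i \<inter> U j = {}"
    "\<And>i. i \<in> I \<Longrightarrow> has_euler (subtopology X (U i)) c"
  shows "has_euler (subtopology X (\<Union>i\<in>I. U i)) (int (card I) * c)"
  using assms
proof (induct I rule: finite_induct)
  case empty then show ?case by (simp add: has_euler_empty)
next
  case (insert i I)
  have "U i \<inter> (\<Union>i\<in>I. U i) = {}" using insert by fastforce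
  then have "has_euler (subtopology X (U i \<union> (\<Union>i\<in>I. U i))) (c + int (card I) * c - 0)"
    using insert by (intro has_euler_open_Un) (auto simp: has_euler_empty)
  then show ?case using insert by (simp add: algebra_simps)
qed

subsection \<open>Points on the line\<close>

text \<open>The coordinates outside of \<open>I\<close> are left unconstrained, so that forgetting coordinates becomes an
  inclusion of sets and homotopy equivalences can be given by straight lines.\<close>

definition no_three_equal :: "'i set \<Rightarrow> ('i \<Rightarrow> real) set" where
  "no_three_equal I =
     {x. \<forall>i\<in>I. \<forall>j\<in>I. \<forall>k\<in>I. x i = x j \<and> x j = x k \<longrightarrow> i = j \<or> j = k \<or> i = k}"

lemma no_three_equal_mono: "J \<subseteq> I \<Longrightarrow> no_three_equal I \<subseteq> no_three_equal J"
  unfolding no_three_equal_def by blast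

lemma no_three_equal_cong:
  assumes "\<And>i. i \<in> I \<Longrightarrow> x i = y i"
  shows "x \<in> no_three_equal I \<longleftrightarrow> y \<in> no_three_equal I"
  using assms unfolding no_three_equal_def by simp

text \<open>The segments from \<open>r x\<close> to \<open>x\<close> stay in \<open>T\<close>, and
  in \<open>S\<close> if they end there. Hence \<open>r\<close> and the inclusion are homotopy
  inverse to each other, even where \<open>r\<close> moves points of \<open>S\<close>.\<close>

lemma homotopy_equivalent_straight_line:
  fixes S T :: "('i \<Rightarrow> real) set"
  assumes "S \<subseteq> T" and r: "\<And>i. continuous_on T (\<lambda>x. r x i)" "\<And>x. x \<in> T \<Longrightarrow> r x \<in> S"
    and T: "\<And>x t. x \<in> T \<Longrightarrow> 0 \<le> t \<Longrightarrow> t \<le> 1 \<Longrightarrow> (\<lambda>i. (1 - t) * r x i + t * x i) \<in> T"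
    and S: "\<And>x t. x \<in> S \<Longrightarrow> 0 \<le> t \<Longrightarrow> t \<le> 1 \<Longrightarrow> (\<lambda>i. (1 - t) * r x i + t * x i) \<in> S"
  shows "top_of_set T homotopy_equivalent_space top_of_set S"
proof -
  have hom: "homotopic_with (\<lambda>x. True) (top_of_set R) (top_of_set R) r id"
    if R: "R \<subseteq> T" "\<And>x t. x \<in> R \<Longrightarrow> 0 \<le> t \<Longrightarrow> t \<le> 1 \<Longrightarrow> (\<lambda>i. (1 - t) * r x i + t * x i) \<in> R" for R
  proof -
    define h where "h = (\<lambda>(t::real, x::'i \<Rightarrow> real). (\<lambda>i. (1 - t) * r x i + t * x i))"
    have cr: "continuous_on ({0..1} \<times> R) (\<lambda>z. r (snd z) i)" for i
      using R(1) by (intro continuous_on_compose2[OF r(1)] continuous_intros) auto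
    have cx: "continuous_on ({0..1} \<times> R) (\<lambda>z. snd z i)" for i
      by (rule continuous_on_product_then_coordinatewise[of _ snd]) (intro continuous_intros)
    have "continuous_on ({0..1::real} \<times> R) h"
      unfolding h_def case_prod_beta
      by (intro continuous_on_coordinatewise_then_product continuous_intros cr cx)
    moreover have "h ` ({0..1} \<times> R) \<subseteq> R" using R(2) by (auto simp: h_def)
    ultimately show ?thesis
      unfolding homotopic_with_def prod_topology_subtopology_eu
      by (intro exI[of _ h]) (auto simp: h_def)
  qed
  have "continuous_on T r" using r(1) by (rule continuous_on_coordinatewise_then_product)
  then have "continuous_map (top_of_set T) (top_of_set S) r" using r(2) by auto
  moreover have "continuous_map (top_of_set S) (top_of_set T) id" using assms(1) by auto
  ultimately show ?thesis
    unfolding homotopy_equivalent_space_def using hom[of S] hom[of T] assms(1) S T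
    by (intro exI[of _ r] exI[of _ id]) auto
qed

text \<open>Without constraints this is the whole function space, which contracts to the zero
  function.\<close>

lemma has_euler_no_three_equal_empty: "has_euler (top_of_set (no_three_equal {} :: ('i \<Rightarrow> real) set)) 1"
proof -
  have "top_of_set (no_three_equal {} :: ('i \<Rightarrow> real) set) homotopy_equivalent_space top_of_set {\<lambda>_::'i. 0::real}"
    by (rule homotopy_equivalent_straight_line[where r = "\<lambda>_ _. 0"]) (auto simp: no_three_equal_def)
  moreover have "has_euler (top_of_set {\<lambda>_::'i. 0::real}) 1"
    by (rule has_euler_singleton) simp
  ultimately show ?thesis
    using has_euler_homotopy_equivalent homotopy_equivalent_space_sym by blast
qed

lemma two_mult_choose_two: "2 * (n choose 2) = n * (n - 1)"
  unfolding choose_two by (rule dvd_mult_div_cancel) (cases n, auto)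

text \<open>\<open>K\<close> lies below all other indices and \<open>E\<close> prescribes an order
  inside \<open>K\<close>. One definition thus serves for a unique minimum, for two lowest
  coordinates, and for two lowest coordinates in a given order. Only triples outside
  \<open>K\<close> are constrained; \<open>minimal_block_eq\<close> treats the others.\<close>

definition minimal_block :: "'i set \<Rightarrow> 'i set \<Rightarrow> ('i \<times> 'i) set \<Rightarrow> ('i \<Rightarrow> real) set" where
  "minimal_block I K E =
     {x \<in> no_three_equal (I - K). (\<forall>i\<in>K. \<forall>k\<in>I - K. x i < x k) \<and> (\<forall>(i, j)\<in>E. x i < x j)}"

text \<open>With the coordinates outside \<open>K\<close> fixed, the remaining conditions are strict
  linear inequalities, hence convex, and they have a solution depending continuously on the fixed
  coordinates. So the coordinates in \<open>K\<close> can be freed up to homotopy.\<close>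

lemma has_euler_minimal_block:
  fixes e :: "'i \<Rightarrow> real"
  assumes "finite I" "E \<subseteq> K \<times> K" "\<And>i j. (i, j) \<in> E \<Longrightarrow> e j < e i" "\<And>i. i \<in> K \<Longrightarrow> 0 < e i"
    and "has_euler (top_of_set (no_three_equal (I - K))) c"
  shows "has_euler (top_of_set (minimal_block I K E)) c"
proof (rule has_euler_homotopy_equivalent[OF _ assms(5)], rule homotopy_equivalent_straight_line)
  \<comment> \<open>Minus the sum of absolute values is a continuous lower bound for the coordinates
    outside \<open>K\<close>. Subtracting the positive \<open>e i\<close> makes it strict, and
    larger values of \<open>e\<close> give smaller coordinates, as \<open>E\<close> demands.\<close>
  define r :: "('i \<Rightarrow> real) \<Rightarrow> 'i \<Rightarrow> real"
    where "r = (\<lambda>x i. if i \<in> K then - (\<Sum>k\<in>I - K. \<bar>x k\<bar>) - e i else x i)"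
  have rK: "r x i < x k" if "i \<in> K" "k \<in> I - K" for x i k
  proof -
    have "\<bar>x k\<bar> \<le> (\<Sum>k\<in>I - K. \<bar>x k\<bar>)"
      using that(2) assms(1) by (intro member_le_sum) auto
    then show ?thesis using assms(4)[OF that(1)] that(1) by (simp add: r_def)
  qed
  have rE: "r x i < r x j" if "(i, j) \<in> E" for x i j
    using that assms(2,3) by (auto simp: r_def)
  have rn: "r x k = x k" if "k \<notin> K" for x k using that by (simp add: r_def)
  show "minimal_block I K E \<subseteq> no_three_equal (I - K)" by (auto simp: minimal_block_def)
  show "continuous_on (no_three_equal (I - K)) (\<lambda>x. r x i)" for i
    by (cases "i \<in> K") (auto simp: r_def intro!: continuous_intros continuous_on_subset[OF continuous_on_product_coordinates])
  show "r x \<in> minimal_block I K E" if "x \<in> no_three_equal (I - K)" for x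
    using that rK rE no_three_equal_cong[of "I - K" "r x" x] by (auto simp: minimal_block_def rn)
  fix t :: real assume t: "0 \<le> t" "t \<le> 1"
  have eq: "(1 - t) * r x k + t * x k = x k" if "k \<notin> K" for x k
    using that by (simp add: rn algebra_simps)
  have T: "(\<lambda>i. (1 - t) * r x i + t * x i) \<in> no_three_equal (I - K)" if "x \<in> no_three_equal (I - K)" for x
    using that no_three_equal_cong[of "I - K" "\<lambda>i. (1 - t) * r x i + t * x i" x] by (simp add: eq)
  then show "(\<lambda>i. (1 - t) * r x i + t * x i) \<in> no_three_equal (I - K)" if "x \<in> no_three_equal (I - K)" for x
    using that .
  \<comment> \<open>Strictness comes from the first inequality, except at \<open>t = 1\<close>,
    where the second one is the claim.\<close>
  have conv: "(1 - t) * a + t * b < (1 - t) * a' + t * b'" if "a < a'" "b < b'" for a b a' b'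
  proof (cases "t = 1")
    case False
    then have "(1 - t) * a < (1 - t) * a'" "t * b \<le> t * b'"
      using that t by (auto intro: mult_left_mono)
    then show ?thesis by simp
  qed (use that in simp)
  fix x assume x: "x \<in> minimal_block I K E"
  have "(1 - t) * r x i + t * x i < (1 - t) * r x k + t * x k" if "i \<in> K" "k \<in> I - K" for i k
    using x that rK[OF that, of x] by (intro conv) (auto simp: minimal_block_def rn)
  moreover have "(1 - t) * r x i + t * x i < (1 - t) * r x j + t * x j" if "(i, j) \<in> E" for i j
    using x that rE[OF that, of x] by (intro conv) (auto simp: minimal_block_def)
  ultimately show "(\<lambda>i. (1 - t) * r x i + t * x i) \<in> minimal_block I K E"
    using x T[of x] by (auto simp: minimal_block_def)
qed

text \<open>Coordinates in \<open>K\<close> differ from those outside, so three equal coordinates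
  lie all in \<open>K\<close> or all outside it, and \<open>K\<close> has no three distinct
  elements.\<close>

lemma minimal_block_eq:
  assumes "K \<subseteq> I" "finite K" "card K \<le> 2"
  shows "minimal_block I K E =
    no_three_equal I \<inter> ({x. \<forall>i\<in>K. \<forall>k\<in>I - K. x i < x k} \<inter> {x. \<forall>(i, j)\<in>E. x i < x j})"
proof -
  have K: "i = j \<or> j = k \<or> i = k" if "i \<in> K" "j \<in> K" "k \<in> K" for i j k
  proof (rule ccontr)
    assume "\<not> ?thesis"
    then have "card {i, j, k} = 3" by auto
    then show False using card_mono[OF assms(2), of "{i, j, k}"] that assms(3) by auto
  qed
  have "x \<in> no_three_equal I" if x: "x \<in> no_three_equal (I - K)" "\<forall>i\<in>K. \<forall>k\<in>I - K. x i < x k" for x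
    unfolding no_three_equal_def
  proof (intro CollectI ballI impI)
    fix i j k assume *: "i \<in> I" "j \<in> I" "k \<in> I" "x i = x j \<and> x j = x k"
    then have "i \<in> K \<and> j \<in> K \<and> k \<in> K \<or> i \<in> I - K \<and> j \<in> I - K \<and> k \<in> I - K"
      using x(2) by (metis DiffI less_irrefl)
    then show "i = j \<or> j = k \<or> i = k"
      using K x(1) *(4) unfolding no_three_equal_def by blast
  qed
  moreover have "no_three_equal I \<subseteq> no_three_equal (I - K)" by (rule no_three_equal_mono) auto
  ultimately show ?thesis unfolding minimal_block_def by blast
qed

lemma open_Collect_coordinate_less: "open {x :: 'i \<Rightarrow> real. x i < x j}"
  by (intro open_Collect_less continuous_on_product_coordinates)

lemma openin_minimal_block:
  fixes I :: "'i set"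
  assumes "K \<subseteq> I" "finite I" "card K \<le> 2" "finite E"
  shows "openin (top_of_set (no_three_equal I)) (minimal_block I K E)"
proof -
  have K: "finite K" using assms(1,2) finite_subset by blast
  have *: "open {x :: 'i \<Rightarrow> real. \<forall>(i, j)\<in>R. x i < x j}" if "finite R" for R
  proof -
    have "{x :: 'i \<Rightarrow> real. \<forall>(i, j)\<in>R. x i < x j} = (\<Inter>(i, j)\<in>R. {x. x i < x j})" by auto
    then show ?thesis using that by (auto intro!: open_INT open_Collect_coordinate_less)
  qed
  have "open {x :: 'i \<Rightarrow> real. \<forall>i\<in>K. \<forall>k\<in>I - K. x i < x k}"
    using *[of "K \<times> (I - K)"] K assms(2) by (simp add: Ball_def imp_conjL)
  moreover have "open {x :: 'i \<Rightarrow> real. \<forall>(i, j)\<in>E. x i < x j}"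
    using assms(4) by (rule *)
  ultimately show ?thesis
    unfolding minimal_block_eq[OF assms(1) K assms(3)] by (intro openin_open_Int open_Int)
qed

lemma has_euler_no_three_equal_step:
  fixes I :: "'i set"
  assumes fin: "finite I" and "I \<noteq> {}"
    and a: "\<And>i. i \<in> I \<Longrightarrow> has_euler (top_of_set (no_three_equal (I - {i}))) a"
    and b: "\<And>K. K \<subseteq> I \<Longrightarrow> card K = 2 \<Longrightarrow> has_euler (top_of_set (no_three_equal (I - K))) b"
  shows "has_euler (top_of_set (no_three_equal I)) (int (card I) * a - int (card I choose 2) * b)"
proof -
  let ?X = "top_of_set (no_three_equal I)"
  \<comment> \<open>\<open>U i\<close> has its unique minimum at \<open>i\<close>, and on
    \<open>N K\<close> the two coordinates in \<open>K\<close> lie below all others.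
    \<open>V (i, j)\<close> is the overlap of \<open>U i\<close> with \<open>N {i, j}\<close>, so
    overlaps are indexed by ordered pairs and there are twice as many as sets
    \<open>N K\<close>.\<close>
  define U where "U = (\<lambda>i. minimal_block I {i} {})"
  define N where "N = (\<lambda>K. minimal_block I K {})"
  define V where "V = (\<lambda>(i, j). minimal_block I {i, j} {(i, j)})"
  define Ks where "Ks = {K. K \<subseteq> I \<and> card K = 2}"
  define P where "P = {(i, j). i \<in> I \<and> j \<in> I \<and> i \<noteq> j}"
  have Peq: "P = I \<times> I - (\<lambda>i. (i, i)) ` I" by (auto simp: P_def)
  have finP: "finite P" unfolding Peq using fin by auto
  have "card P = card I * card I - card I"
    unfolding Peq using fin by (subst card_Diff_subset) (auto simp: card_image inj_on_def card_cartesian_product)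
  also have "\<dots> = card I * (card I - 1)" by (simp add: diff_mult_distrib2)
  also have "\<dots> = 2 * (card I choose 2)"
    by (rule two_mult_choose_two[symmetric])
  finally have cardP: "int (card P) = 2 * int (card I choose 2)" by simp
  have finKs: "finite Ks" and cardKs: "card Ks = card I choose 2"
    unfolding Ks_def using fin by (auto simp: n_subsets)
  have Kfin: "finite K" if "K \<in> Ks" for K using that fin by (auto simp: Ks_def finite_subset)
  have Ueq: "U i = no_three_equal I \<inter> {x. \<forall>k\<in>I - {i}. x i < x k}" if "i \<in> I" for i
    using that by (simp add: U_def minimal_block_eq)
  have Neq: "N K = no_three_equal I \<inter> {x. \<forall>i\<in>K. \<forall>k\<in>I - K. x i < x k}" if "K \<in> Ks" for K
    using that Kfin[OF that] by (simp add: N_def minimal_block_eq Ks_def)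
  have Veq: "V (i, j) = no_three_equal I \<inter> {x. x i < x j \<and> (\<forall>k\<in>I - {i, j}. x i < x k \<and> x j < x k)}"
    if "(i, j) \<in> P" for i j
    using that unfolding V_def P_def by (auto simp: minimal_block_eq)
  have sub: "subtopology ?X A = top_of_set A" if "openin ?X A" for A
    using openin_subset[OF that] by (simp add: subtopology_subtopology Int_absorb1)
  have oU: "openin ?X (U i)" if "i \<in> I" for i
    using that fin unfolding U_def by (intro openin_minimal_block) auto
  have oN: "openin ?X (N K)" if "K \<in> Ks" for K
    using that fin unfolding N_def Ks_def by (intro openin_minimal_block) auto
  have oV: "openin ?X (V p)" if "p \<in> P" for p
    using that fin unfolding V_def P_def case_prod_beta by (intro openin_minimal_block) auto
  have "has_euler (subtopology ?X (\<Union>i\<in>I. U i)) (int (card I) * a)"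
  proof (rule has_euler_disjoint_UN[OF fin oU])
    fix i j assume ij: "i \<in> I" "j \<in> I" "i \<noteq> j"
    have "x i < x j \<and> x j < x i" if "x \<in> U i \<inter> U j" for x
      using that ij unfolding Ueq[OF ij(1)] Ueq[OF ij(2)] by simp
    then show "U i \<inter> U j = {}" by (meson equals0I less_asym)
  next
    fix i assume i: "i \<in> I"
    show "has_euler (subtopology ?X (U i)) a"
      unfolding sub[OF oU[OF i]] unfolding U_def
      by (rule has_euler_minimal_block[where e = "\<lambda>_. 1"]) (use fin a i in auto)
  qed
  moreover have "has_euler (subtopology ?X (\<Union>K\<in>Ks. N K)) (int (card Ks) * b)"
  proof (rule has_euler_disjoint_UN[OF finKs oN])
    fix K L assume KL: "K \<in> Ks" "L \<in> Ks" "K \<noteq> L"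
    have "card K = 2" "card L = 2" "finite K" "finite L"
      using KL(1,2) Kfin[OF KL(1)] Kfin[OF KL(2)] by (simp_all add: Ks_def)
    \<comment> \<open>Distinct sets of equal size each contain an index missing from the other;
      these two indices would be strictly below each other.\<close>
    then have "\<not> K \<subseteq> L" "\<not> L \<subseteq> K"
      using KL(3) card_subset_eq[of L K] card_subset_eq[of K L] by metis+
    then obtain k l where "k \<in> K" "k \<notin> L" "l \<in> L" "l \<notin> K" by blast
    moreover have "k \<in> I" "l \<in> I" using calculation KL(1,2) unfolding Ks_def by blast+
    ultimately have "x k < x l \<and> x l < x k" if "x \<in> N K \<inter> N L" for x
      using that unfolding Neq[OF KL(1)] Neq[OF KL(2)] by simp
    then show "N K \<inter> N L = {}" by (meson equals0I less_asym)
  next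
    fix K assume K: "K \<in> Ks"
    show "has_euler (subtopology ?X (N K)) b"
      unfolding sub[OF oN[OF K]] unfolding N_def
      by (rule has_euler_minimal_block[where e = "\<lambda>_. 1"]) (use fin b K in \<open>auto simp: Ks_def\<close>)
  qed
  moreover have "has_euler (subtopology ?X (\<Union>p\<in>P. V p)) (int (card P) * b)"
  proof (rule has_euler_disjoint_UN[OF finP oV])
    fix p q assume pq: "p \<in> P" "q \<in> P" "p \<noteq> q"
    obtain i j k l where [simp]: "p = (i, j)" "q = (k, l)" by (metis surj_pair)
    have mem: "i \<in> I" "j \<in> I" "i \<noteq> j" "k \<in> I" "l \<in> I" "k \<noteq> l" "\<not> (i = k \<and> j = l)"
      using pq by (auto simp: P_def)
    show "V p \<inter> V q = {}"
    proof (rule equals0I)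
      fix x assume "x \<in> V p \<inter> V q"
      then have x: "x i < x j" "\<And>m. m \<in> I - {i, j} \<Longrightarrow> x i < x m \<and> x j < x m"
        "x k < x l" "\<And>m. m \<in> I - {k, l} \<Longrightarrow> x k < x m \<and> x l < x m"
        using pq Veq[of i j] Veq[of k l] by auto
      \<comment> \<open>Both \<open>i\<close> and \<open>k\<close> carry the strict minimum;
        afterwards \<open>j\<close> and \<open>l\<close> both carry the second smallest
        value.\<close>
      have "i = k"
      proof (rule ccontr)
        assume "i \<noteq> k"
        have "x i < x k" using \<open>i \<noteq> k\<close> x(1,2) mem by (cases "k = j") auto
        moreover have "x k < x i" using \<open>i \<noteq> k\<close> x(3,4) mem by (cases "i = l") auto
        ultimately show False by simp
      qed
      then have "x j < x l" "x l < x j" using x(2)[of l] x(4)[of j] mem by auto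
      then show False by simp
    qed
  next
    fix p assume p: "p \<in> P"
    show "has_euler (subtopology ?X (V p)) b"
      unfolding sub[OF oV[OF p]] unfolding V_def case_prod_beta
      \<comment> \<open>The larger offset at the first index places it below the second.\<close>
      by (rule has_euler_minimal_block[where e = "\<lambda>i. if i = fst p then 2 else 1"])
         (use fin b[of "{fst p, snd p}"] p in \<open>auto simp: P_def\<close>)
  qed
  moreover have "(\<Union>i\<in>I. U i) \<inter> (\<Union>K\<in>Ks. N K) = (\<Union>p\<in>P. V p)"
  proof (intro equalityI subsetI)
    fix x assume "x \<in> (\<Union>i\<in>I. U i) \<inter> (\<Union>K\<in>Ks. N K)"
    then obtain i K where i: "i \<in> I" "x \<in> U i" and K: "K \<in> Ks" "x \<in> N K" by blast
    have "i \<in> K"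
    proof (rule ccontr)
      assume "i \<notin> K"
      obtain k where "k \<in> K" using K(1) by (fastforce simp: Ks_def)
      then have "x k < x i" "x i < x k"
        using i K \<open>i \<notin> K\<close> Ueq[of i] Neq[of K] by (auto simp: Ks_def)
      then show False by simp
    qed
    then obtain j where j: "K = {i, j}" "i \<noteq> j"
      using K(1) by (auto simp: Ks_def card_2_iff)
    have ij: "(i, j) \<in> P" using j K(1) by (auto simp: P_def Ks_def)
    then have "x \<in> V (i, j)"
      using i K Ueq[of i] Neq[of K] Veq[OF ij] j by (auto simp: P_def)
    with ij show "x \<in> (\<Union>p\<in>P. V p)" by blast
  next
    fix x assume "x \<in> (\<Union>p\<in>P. V p)"
    then obtain i j where ij: "(i, j) \<in> P" "x \<in> V (i, j)" by auto
    then have K: "{i, j} \<in> Ks" by (auto simp: P_def Ks_def)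
    have "x \<in> U i" "x \<in> N {i, j}"
      using ij Ueq[of i] Neq[OF K] Veq[OF ij(1)] by (auto simp: P_def)
    with ij K show "x \<in> (\<Union>i\<in>I. U i) \<inter> (\<Union>K\<in>Ks. N K)" by (auto simp: P_def)
  qed
  moreover have "(\<Union>i\<in>I. U i) \<union> (\<Union>K\<in>Ks. N K) = no_three_equal I"
  proof (intro equalityI subsetI)
    fix x assume x: "x \<in> no_three_equal I"
    \<comment> \<open>The set of minimising indices has one or two elements because no three
      coordinates agree; the two cases give \<open>U\<close> and \<open>N\<close>.\<close>
    define A where "A = {i \<in> I. x i = Min (x ` I)}"
    have A: "A \<subseteq> I" "finite A" using fin by (auto simp: A_def)
    have "Min (x ` I) \<in> x ` I" using fin assms(2) by (intro Min_in) auto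
    then obtain i where i: "i \<in> A" by (force simp: A_def)
    have less: "x i < x k" if "i \<in> A" "k \<in> I - A" for i k
      proof -
      have "Min (x ` I) \<le> x k" using that(2) fin by (intro Min_le) auto
      then show ?thesis using that by (auto simp: A_def order_less_le)
    qed
    show "x \<in> (\<Union>i\<in>I. U i) \<union> (\<Union>K\<in>Ks. N K)"
    proof (cases "A = {i}")
      case True
      then have "i \<in> I" using A by blast
      moreover have "x \<in> U i" unfolding Ueq[OF calculation] using x less[of i] True by simp
      ultimately show ?thesis by blast
    next
      case False
      then obtain j where j: "j \<in> A" "i \<noteq> j" using i by blast
      have "k = i \<or> k = j" if "k \<in> A" for k
      proof -
        have "x i = x j \<and> x j = x k" "i \<in> I" "j \<in> I" "k \<in> I"
          using i j(1) that by (auto simp: A_def)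
        then show ?thesis using x j(2) unfolding no_three_equal_def by blast
      qed
      then have "A = {i, j}" using i j(1) by blast
      then have "A \<in> Ks" using j A by (auto simp: Ks_def)
      moreover have "x \<in> N A" unfolding Neq[OF calculation] using x less by simp
      ultimately show ?thesis by blast
    qed
  next
    fix x assume "x \<in> (\<Union>i\<in>I. U i) \<union> (\<Union>K\<in>Ks. N K)"
    then show "x \<in> no_three_equal I" using Ueq Neq by blast
  qed
  moreover have "openin ?X (\<Union>i\<in>I. U i)" "openin ?X (\<Union>K\<in>Ks. N K)"
    using oU oN by (blast intro: openin_Union)+
  ultimately have "has_euler (subtopology ?X (no_three_equal I))
      (int (card I) * a + int (card Ks) * b - int (card P) * b)"
    using has_euler_open_Un[of ?X "\<Union>i\<in>I. U i" "\<Union>K\<in>Ks. N K"] by simp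
  \<comment> \<open>The pairs contribute \<open>b\<close> once each through \<open>N\<close> and
    minus twice through the overlaps, which leaves the negative sign.\<close>
  then show ?thesis
    by (simp add: sub cardP cardKs algebra_simps)
qed

fun euler_line :: "nat \<Rightarrow> int" where
  "euler_line 0 = 1"
| "euler_line (Suc 0) = 1"
| "euler_line (Suc (Suc n)) = int (Suc (Suc n)) * euler_line (Suc n) - int (Suc (Suc n) choose 2) * euler_line n"

lemma has_euler_no_three_equal:
  assumes "finite I"
  shows "has_euler (top_of_set (no_three_equal I)) (euler_line (card I))"
  using assms
proof (induction "card I" arbitrary: I rule: less_induct)
  case less
  show ?case
  proof (cases "I = {}")
    case True
    then show ?thesis using has_euler_no_three_equal_empty by simp
  next
    case False
    define n where "n = card I"
    have n: "n > 0" using False less.prems by (auto simp: n_def)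
    have a: "has_euler (top_of_set (no_three_equal (I - {i}))) (euler_line (n - 1))" if "i \<in> I" for i
      using less.hyps[of "I - {i}"] less.prems that n by (simp add: n_def)
    have b: "has_euler (top_of_set (no_three_equal (I - K))) (euler_line (n - 2))"
      if "K \<subseteq> I" "card K = 2" for K
      using less.hyps[of "I - K"] less.prems that n card_Diff_subset[of K I]
      by (simp add: n_def finite_subset)
    \<comment> \<open>This form also covers \<open>n = 1\<close>: there \<open>n choose 2\<close> is
      0 and cancels the term with the truncated index \<open>n - 2\<close>.\<close>
    have "euler_line n = int n * euler_line (n - 1) - int (n choose 2) * euler_line (n - 2)"
    proof (cases n rule: euler_line.cases)
      case (3 m)
      then have "n - 1 = Suc m" "n - 2 = m" by auto
      then show ?thesis by (simp only: 3 euler_line.simps)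
    qed (use n in auto)
    moreover have "has_euler (top_of_set (no_three_equal I))
        (int n * euler_line (n - 1) - int (n choose 2) * euler_line (n - 2))"
      unfolding n_def using a b
      by (intro has_euler_no_three_equal_step less.prems False) (simp_all add: n_def)
    ultimately show ?thesis by (simp add: n_def)
  qed
qed

subsection \<open>Cayley charts of the circle\<close>

text \<open>\<open>cayley w\<close> parametrises the circle without \<open>w\<close>, and \<open>cayley (- w)\<close> a neighbourhood of \<open>w\<close>, with
  parameter \<open>0\<close> at \<open>w\<close>.\<close>

definition cayley :: "complex \<Rightarrow> real \<Rightarrow> complex" where
  "cayley w t = w * (of_real t + \<i>) / (of_real t - \<i>)"

text \<open>For distinct \<open>z\<close> and \<open>w\<close> on the unit circle the quotient is
  already real, so \<open>Re\<close> only changes the type.\<close>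

definition cayley_inv :: "complex \<Rightarrow> complex \<Rightarrow> real" where
  "cayley_inv w z = Re (\<i> * (z + w) / (z - w))"

lemma of_real_neq_ii [simp]:
  "complex_of_real t \<noteq> \<i>" "complex_of_real t + \<i> \<noteq> 0" "\<i> + complex_of_real t \<noteq> 0"
  by (auto simp: complex_eq_iff)

lemma norm_of_real_plus_ii:
  "norm (complex_of_real t - \<i>) = sqrt (t\<^sup>2 + 1)" "norm (complex_of_real t + \<i>) = sqrt (t\<^sup>2 + 1)"
  by (simp_all add: cmod_def)

lemma norm_cayley: "norm w = 1 \<Longrightarrow> norm (cayley w t) = 1"
  by (simp add: cayley_def norm_mult norm_divide norm_of_real_plus_ii)
     (metis add_nonneg_eq_0_iff one_neq_zero real_sqrt_eq_zero_cancel_iff zero_le_one zero_le_power2)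

lemma cayley_diff: "cayley w t - w = w * (2 * \<i>) / (of_real t - \<i>)"
  by (simp add: cayley_def field_simps)

lemma cayley_add: "cayley w t + w = w * (2 * of_real t) / (of_real t - \<i>)"
  by (simp add: cayley_def field_simps)

lemma cayley_neq: "norm w = 1 \<Longrightarrow> cayley w t \<noteq> w"
  using cayley_diff[of w t] by auto

lemma cayley_inv_cayley:
  assumes "norm w = 1" shows "cayley_inv w (cayley w t) = t"
proof -
  have "w \<noteq> 0" using assms by auto
  then have "\<i> * (cayley w t + w) / (cayley w t - w) = of_real t"
    unfolding cayley_diff cayley_add by simp
  then show ?thesis by (simp add: cayley_inv_def)
qed

lemma cayley_cayley_inv:
  assumes "norm w = 1" "norm z = 1" "z \<noteq> w" shows "cayley w (cayley_inv w z) = z"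
proof -
  have [simp]: "w \<noteq> 0" "z \<noteq> 0" using assms by auto
  define v where "v = \<i> * (z + w) / (z - w)"
  have cnj: "cnj w = 1 / w" "cnj z = 1 / z"
    using assms by (simp_all add: complex_div_cnj[of 1] divide_conv_cnj)
  \<comment> \<open>On the unit circle conjugation is inversion, under which \<open>v\<close> is
    invariant; hence \<open>v\<close> is real.\<close>
  have "cnj v = v"
    using assms(3) by (simp add: v_def cnj field_simps)
  then have v: "of_real (cayley_inv w z) = v"
    by (simp add: cayley_inv_def v_def[symmetric] complex_eq_iff)
  have v': "v + \<i> = \<i> * (2 * z) / (z - w)" "v - \<i> = \<i> * (2 * w) / (z - w)"
    using assms(3) by (simp_all add: v_def field_simps)
  then show ?thesis
    unfolding cayley_def v mult.commute[of w] times_divide_eq_left[symmetric] v' using assms(3) by simp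
qed

lemma range_cayley:
  assumes "norm w = 1" shows "range (cayley w) = sphere 0 1 - {w}"
proof (intro equalityI subsetI)
  fix z assume "z \<in> sphere 0 1 - {w}"
  then have "cayley w (cayley_inv w z) = z" by (intro cayley_cayley_inv assms) auto
  then show "z \<in> range (cayley w)" by (metis rangeI)
qed (use assms norm_cayley cayley_neq in auto)

lemma cayley_eq_iff: "norm w = 1 \<Longrightarrow> cayley w s = cayley w t \<longleftrightarrow> s = t"
  by (metis cayley_inv_cayley)

lemma continuous_map_cayley:
  assumes "norm w = 1" shows "continuous_map euclideanreal circle (cayley w)"
proof -
  have "continuous_on UNIV (cayley w)"
    unfolding cayley_def[abs_def] by (intro continuous_intros) simp
  then show ?thesis
    unfolding circle_def using norm_cayley[OF assms] by (auto simp: continuous_map_in_subtopology)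
qed

lemma continuous_map_cayley_inv:
  assumes "norm w = 1"
  shows "continuous_map (subtopology circle (range (cayley w))) euclideanreal (cayley_inv w)"
  unfolding circle_def range_cayley[OF assms] subtopology_subtopology
  by (auto simp: cayley_inv_def[abs_def] intro!: continuous_intros)

lemma dist_cayley: "norm w = 1 \<Longrightarrow> dist (cayley w t) w = 2 / sqrt (t\<^sup>2 + 1)"
  by (simp add: dist_norm cayley_diff norm_mult norm_divide norm_of_real_plus_ii)

lemma dist_cayley_uminus: "norm w = 1 \<Longrightarrow> dist (cayley (- w) t) w = 2 * \<bar>t\<bar> / sqrt (t\<^sup>2 + 1)"
  using cayley_add[of "- w" t] by (simp add: dist_norm norm_mult norm_divide norm_of_real_plus_ii)

text \<open>This turns the condition of being nearer to \<open>w\<close> into a bound on a product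
  of parameters, convex in each of them. After squaring, the two distance formulas differ only by
  the term \<open>(s * t)\<^sup>2\<close> against 1.\<close>

lemma dist_cayley_less_iff:
  assumes "norm w = 1"
  shows "dist (cayley (- w) s) w < dist (cayley w t) w \<longleftrightarrow> \<bar>s\<bar> * \<bar>t\<bar> < 1"
proof -
  have pos: "0 < sqrt (s\<^sup>2 + 1)" "0 < sqrt (t\<^sup>2 + 1)"
    by (simp_all add: add_nonneg_pos)
  have "dist (cayley (- w) s) w < dist (cayley w t) w \<longleftrightarrow> \<bar>s\<bar> * sqrt (t\<^sup>2 + 1) < sqrt (s\<^sup>2 + 1)"
    unfolding dist_cayley[OF assms] dist_cayley_uminus[OF assms] using pos by (simp add: field_simps)
  also have "\<bar>s\<bar> * sqrt (t\<^sup>2 + 1) = sqrt (s\<^sup>2 * (t\<^sup>2 + 1))" by (simp add: real_sqrt_mult)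
  also have "\<dots> < sqrt (s\<^sup>2 + 1) \<longleftrightarrow> (s * t)\<^sup>2 < 1"
    by (simp add: power_mult_distrib algebra_simps)
  also have "\<dots> \<longleftrightarrow> \<bar>s\<bar> * \<bar>t\<bar> < 1"
    by (simp add: abs_square_less_1 abs_mult)
  finally show ?thesis .
qed

text \<open>The sign of this imaginary part is the sign of the chart parameter, so it tells the two
  sides of \<open>w\<close> apart without reference to a chart.\<close>

lemma Im_divide_cayley_uminus:
  assumes "norm w = 1" shows "Im (w / cayley (- w) t) = 2 * t / (t\<^sup>2 + 1)"
proof -
  have "w \<noteq> 0" using assms by auto
  then have "w / cayley (- w) t = - ((of_real t - \<i>) / (of_real t + \<i>))"
    by (simp add: cayley_def)
  also have "Im \<dots> = 2 * t / (t\<^sup>2 + 1)"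
    by (simp add: Im_divide power2_eq_square)
  finally show ?thesis .
qed

text \<open>Applying the charts coordinatewise identifies \<open>S\<close> with a set of real
  functions on \<open>I\<close>. The functions on the right also have free coordinates outside
  \<open>I\<close>, so the result is a homotopy equivalence, obtained by contracting these to
  0.\<close>

lemma has_euler_charts:
  fixes Y :: "'i \<Rightarrow> 'b topology" and \<phi> :: "'i \<Rightarrow> real \<Rightarrow> 'b"
  assumes \<phi>: "\<And>i. i \<in> I \<Longrightarrow> continuous_map euclideanreal (Y i) (\<phi> i)"
    and \<psi>: "\<And>i. i \<in> I \<Longrightarrow> continuous_map (subtopology (Y i) (range (\<phi> i))) euclideanreal (\<psi> i)"
    and inv: "\<And>i t. i \<in> I \<Longrightarrow> \<psi> i (\<phi> i t) = t"
    and S: "S \<subseteq> (\<Pi>\<^sub>E i\<in>I. range (\<phi> i))"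
    and c: "has_euler (top_of_set {y. (\<lambda>i\<in>I. \<phi> i (y i)) \<in> S}) c"
  shows "has_euler (subtopology (product_topology Y I) S) c"
proof (rule has_euler_homotopy_equivalent[OF _ c])
  define P where "P = product_topology Y I"
  define S' where "S' = {y. (\<lambda>i\<in>I. \<phi> i (y i)) \<in> S}"
  define f where "f = (\<lambda>y. \<lambda>i\<in>I. \<phi> i (y i))"
  define g where "g = (\<lambda>x i. if i \<in> I then \<psi> i (x i) else 0)"
  have fg: "f (g x) = x" if "x \<in> S" for x
  proof
    fix i
    show "f (g x) i = x i"
    proof (cases "i \<in> I")
      case True
      then have "x i \<in> range (\<phi> i)" using that S by (auto simp: PiE_iff)
      then show ?thesis using True inv by (auto simp: f_def g_def)
    next
      case False
      then have "x i = undefined" using that S PiE_arb by blast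
      then show ?thesis using False by (simp add: f_def)
    qed
  qed
  have gf: "g (f y) = (\<lambda>i. if i \<in> I then y i else 0)" for y
    by (auto simp: f_def g_def inv)
  have S'_cong: "y \<in> S'" if "y' \<in> S'" "\<And>i. i \<in> I \<Longrightarrow> y i = y' i" for y y'
  proof -
    have "(\<lambda>i\<in>I. \<phi> i (y i)) = (\<lambda>i\<in>I. \<phi> i (y' i))" using that(2) by auto
    then show ?thesis using that(1) by (simp add: S'_def)
  qed
  have "continuous_map (top_of_set S') (Y i) (\<lambda>y. \<phi> i (y i))" if "i \<in> I" for i
  proof -
    have "continuous_map (top_of_set S') euclideanreal (\<lambda>y. y i)"
      by (auto intro: continuous_on_subset[OF continuous_on_product_coordinates])
    from continuous_map_compose[OF this \<phi>[OF that]] show ?thesis by (simp add: o_def)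
  qed
  then have "continuous_map (top_of_set S') P f"
    unfolding P_def f_def by (subst continuous_map_componentwise) auto
  then have cf: "continuous_map (top_of_set S') (subtopology P S) f"
    by (auto simp: continuous_map_in_subtopology S'_def f_def)
  have "continuous_map (subtopology P S) euclideanreal (\<lambda>x. g x i)" for i
  proof (cases "i \<in> I")
    case True
    have "continuous_map (subtopology P S) (subtopology (Y i) (range (\<phi> i))) (\<lambda>x. x i)"
      using True S unfolding P_def
      by (auto simp: continuous_map_in_subtopology PiE_iff subset_iff
          intro!: continuous_map_from_subtopology continuous_map_product_projection)
    from continuous_map_compose[OF this \<psi>[OF True]] show ?thesis
      using True by (simp add: o_def g_def)
  qed (simp add: g_def)
  then have "continuous_map (subtopology P S) euclidean g"
    by (simp add: euclidean_product_topology[symmetric] continuous_map_componentwise_UNIV)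
  moreover have "g x \<in> S'" if "x \<in> topspace (subtopology P S)" for x
    using fg[of x] that by (auto simp: S'_def f_def)
  ultimately have cg: "continuous_map (subtopology P S) (top_of_set S') g"
    by (auto simp: continuous_map_in_subtopology)
  have "homotopic_with (\<lambda>x. True) (subtopology P S) (subtopology P S) (f \<circ> g) id"
    by (rule homotopic_with_equal) (auto simp: fg intro: continuous_map_compose[OF cg cf])
  moreover have "homotopic_with (\<lambda>x. True) (top_of_set S') (top_of_set S') (g \<circ> f) id"
  proof -
    define h where "h = (\<lambda>(t::real, y::'i \<Rightarrow> real) i. if i \<in> I then y i else t * y i)"
    have *: "continuous_on ({0..1::real} \<times> S') (\<lambda>z. snd z i)" for i
      by (rule continuous_on_product_then_coordinatewise[of _ snd]) (intro continuous_intros)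
    have "continuous_on ({0..1::real} \<times> S') (\<lambda>z. h z i)" for i
      unfolding h_def case_prod_beta by (cases "i \<in> I") (auto intro!: continuous_intros *)
    then have "continuous_on ({0..1} \<times> S') h"
      by (rule continuous_on_coordinatewise_then_product)
    moreover have "h ` ({0..1} \<times> S') \<subseteq> S'"
      using S'_cong by (fastforce simp: h_def)
    ultimately show ?thesis
      unfolding homotopic_with_def prod_topology_subtopology_eu
      by (intro exI[of _ h]) (auto simp: h_def gf)
  qed
  ultimately show "top_of_set {y. (\<lambda>i\<in>I. \<phi> i (y i)) \<in> S} homotopy_equivalent_space
      subtopology (product_topology Y I) S"
    unfolding homotopy_equivalent_space_def using cf cg unfolding S'_def P_def by blast
qed

subsection \<open>Closed form of the recursion\<close>

text \<open>\<open>c n\<close> and \<open>s n\<close> are the real and imaginary parts of the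
  \<open>n\<close>-th power of (1 + i) / 2.\<close>

lemma two_powr_cos_sin_Suc:
  fixes n :: nat
  defines "c \<equiv> \<lambda>n::nat. 2 powr (- real n / 2) * cos (pi * real n / 4)"
    and "s \<equiv> \<lambda>n::nat. 2 powr (- real n / 2) * sin (pi * real n / 4)"
  shows "c (Suc n) = (c n - s n) / 2" "s (Suc n) = (c n + s n) / 2"
proof -
  have p: "2 powr (- real (Suc n) / 2) = 2 powr (- real n / 2) / sqrt (2 :: real)"
  proof -
    have "- real (Suc n) / 2 = - real n / 2 - 1 / 2" by (simp add: field_simps)
    then show ?thesis by (simp only: powr_diff) (simp add: powr_half_sqrt)
  qed
  have a: "pi * real (Suc n) / 4 = pi * real n / 4 + pi / 4" by (simp add: field_simps)
  have q: "sqrt 2 / 2 = 1 / sqrt (2 :: real)" by (simp add: field_simps)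
  show "c (Suc n) = (c n - s n) / 2" "s (Suc n) = (c n + s n) / 2"
    unfolding c_def s_def p a cos_add sin_add cos_45 sin_45 q by (simp_all add: field_simps)
qed

text \<open>Divided by \<open>fact n\<close>, the recursion becomes l (n + 2) = l (n + 1) - l n / 2,
  whose characteristic roots are (1 + i) / 2 and its conjugate.\<close>

lemma euler_line_closed_form:
  "real_of_int (euler_line n) =
    fact n * (2 powr (- real n / 2) * cos (pi * real n / 4) + 2 powr (- real n / 2) * sin (pi * real n / 4))"
proof (induct n rule: euler_line.induct)
  case 2
  show ?case
    using two_powr_cos_sin_Suc[of 0] by simp
next
  case (3 n)
  define c where "c = (\<lambda>n::nat. 2 powr (- real n / 2) * cos (pi * real n / 4))"
  define s where "s = (\<lambda>n::nat. 2 powr (- real n / 2) * sin (pi * real n / 4))"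
  have S: "c (Suc n) = (c n - s n) / 2" "s (Suc n) = (c n + s n) / 2" for n
    unfolding c_def s_def by (rule two_powr_cos_sin_Suc)+
  have ch: "real (Suc (Suc n) choose 2) = real (Suc (Suc n)) * real (Suc n) / 2"
    using arg_cong[OF two_mult_choose_two[of "Suc (Suc n)"], of real] by (simp add: algebra_simps del: binomial_Suc_Suc)
  have "real_of_int (euler_line (Suc (Suc n))) =
     real (Suc (Suc n)) * (fact (Suc n) * (c (Suc n) + s (Suc n)))
      - real (Suc (Suc n)) * real (Suc n) / 2 * (fact n * (c n + s n))"
    using 3 unfolding c_def s_def by (simp only: euler_line.simps of_int_diff of_int_mult of_int_of_nat_eq ch)
  also have "\<dots> = fact (Suc (Suc n)) * (c (Suc n) + s (Suc n) - (c n + s n) / 2)"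
    by (simp add: field_simps)
  also have "c (Suc n) + s (Suc n) - (c n + s n) / 2 = c (Suc (Suc n)) + s (Suc (Suc n))"
    by (simp add: S field_simps)
  finally show ?case by (simp only: c_def s_def)
qed simp

lemma euler_circle_closed_form:
  assumes "n \<ge> 1"
  shows "real_of_int (euler_line (n - 1) - int (n - 1) * euler_line (n - 2)) =
    fact (n - 1) * 2 powr (1 - real n / 2) * cos (pi * real n / 4)"
proof -
  define c where "c = (\<lambda>n::nat. 2 powr (- real n / 2) * cos (pi * real n / 4))"
  define s where "s = (\<lambda>n::nat. 2 powr (- real n / 2) * sin (pi * real n / 4))"
  have S: "c (Suc n) = (c n - s n) / 2" "s (Suc n) = (c n + s n) / 2" for n
    unfolding c_def s_def by (rule two_powr_cos_sin_Suc)+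
  have L: "real_of_int (euler_line n) = fact n * (c n + s n)" for n
    unfolding c_def s_def by (rule euler_line_closed_form)
  have "2 powr (1 - real n / 2) = 2 * 2 powr (- real n / 2)"
    using powr_add[of 2 1 "- real n / 2"] by simp
  then have rhs: "fact (n - 1) * 2 powr (1 - real n / 2) * cos (pi * real n / 4) = fact (n - 1) * (2 * c n)"
    by (simp add: c_def)
  show ?thesis
  \<comment> \<open>At \<open>n = 1\<close> the index \<open>n - 2\<close> is truncated, but its
    coefficient \<open>n - 1\<close> is 0.\<close>
  proof (cases "n = 1")
    case True
    then show ?thesis unfolding rhs using S(1)[of 0] by (simp add: c_def s_def)
  next
    case False
    then obtain m where m: "n = Suc (Suc m)" using assms by (cases n rule: euler_line.cases) auto
    have "real_of_int (euler_line (n - 1) - int (n - 1) * euler_line (n - 2))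
       = fact (Suc m) * (c (Suc m) + s (Suc m)) - real (Suc m) * (fact m * (c m + s m))"
      by (simp add: m L)
    also have "\<dots> = fact (Suc m) * (c (Suc m) + s (Suc m) - (c m + s m))"
      by (simp add: field_simps)
    also have "c (Suc m) + s (Suc m) - (c m + s m) = 2 * c n"
      by (simp add: m S field_simps)
    finally show ?thesis unfolding rhs by (simp add: m)
  qed
qed

subsection \<open>Points on the circle\<close>

text \<open>A triple \<open>i < j < k\<close> with \<open>k < n\<close> concerns free points only.
  With \<open>k = n\<close> it says that two free points both equal \<open>w\<close>.\<close>

lemma mem_topspace_no_three_equal_space:
  "x \<in> topspace (no_three_equal_space n w) \<longleftrightarrow> x \<in> (\<Pi>\<^sub>E i\<in>{1..<n}. sphere 0 1) \<and>
     (\<forall>i\<in>{1..<n}. \<forall>j\<in>{1..<n}. \<forall>k\<in>{1..<n}. x i = x j \<and> x j = x k \<longrightarrow> i = j \<or> j = k \<or> i = k) \<and>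
     (\<forall>i\<in>{1..<n}. \<forall>j\<in>{1..<n}. x i = w \<and> x j = w \<longrightarrow> i = j)" (is "?L \<longleftrightarrow> ?E \<and> ?A \<and> ?B")
proof -
  define T where "T = (\<lambda>i j k. (x(n := w)) i = (x(n := w)) j \<and> (x(n := w)) j = (x(n := w)) k)"
  have "?L \<longleftrightarrow> ?E \<and> (\<forall>i j k. 1 \<le> i \<and> i < j \<and> j < k \<and> k \<le> n \<longrightarrow> \<not> T i j k)"
  proof -
    have top: "topspace (torus n) = (\<Pi>\<^sub>E i\<in>{1..<n}. sphere 0 1)"
      by (simp add: torus_def circle_def)
    have "?L \<longleftrightarrow> x \<in> topspace (torus n) \<and>
        (\<forall>i j k. 1 \<le> i \<and> i < j \<and> j < k \<and> k \<le> n \<longrightarrow> x \<notin> triple_coincidence n w i j k)"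
      unfolding no_three_equal_space_def topspace_subtopology by blast
    then show ?thesis
      unfolding triple_coincidence_def T_def top by blast
  qed
  also have "(\<forall>i j k. 1 \<le> i \<and> i < j \<and> j < k \<and> k \<le> n \<longrightarrow> \<not> T i j k) \<longleftrightarrow> ?A \<and> ?B"
  proof (intro iffI conjI)
    assume T: "\<forall>i j k. 1 \<le> i \<and> i < j \<and> j < k \<and> k \<le> n \<longrightarrow> \<not> T i j k"
    have A: "\<not> (x i = x j \<and> x j = x k)" if "1 \<le> i" "i < j" "j < k" "k < n" for i j k
      using T[rule_format, of i j k] that by (simp add: T_def)
    have B: "\<not> (x i = w \<and> x j = w)" if "1 \<le> i" "i < j" "j < n" for i j
      using T[rule_format, of i j n] that by (auto simp: T_def)
    show ?A
    proof (intro ballI impI)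
      fix i j k assume *: "i \<in> {1..<n}" "j \<in> {1..<n}" "k \<in> {1..<n}" "x i = x j \<and> x j = x k"
      then show "i = j \<or> j = k \<or> i = k"
        by (metis A atLeastLessThan_iff linorder_neqE_nat)
    qed
    show ?B by (metis B atLeastLessThan_iff linorder_neqE_nat)
  next
    assume AB: "?A \<and> ?B"
    show "\<forall>i j k. 1 \<le> i \<and> i < j \<and> j < k \<and> k \<le> n \<longrightarrow> \<not> T i j k"
    proof (intro allI impI notI)
      fix i j k assume *: "1 \<le> i \<and> i < j \<and> j < k \<and> k \<le> n" "T i j k"
      then have ij: "i \<in> {1..<n}" "j \<in> {1..<n}" "i \<noteq> j" "j \<noteq> k" "i \<noteq> k" by auto
      show False
      proof (cases "k = n")
        case True
        then have "x i = w \<and> x j = w" using * by (auto simp: T_def)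
        then show False using AB ij by blast
      next
        case False
        then have "k \<in> {1..<n}" "x i = x j \<and> x j = x k" using * by (auto simp: T_def)
        then show False using AB ij by blast
      qed
    qed
  qed
  finally show ?thesis .
qed

text \<open>Both in \<open>near_chart\<close> and in \<open>near_block\<close>, the values \<open>g = 1\<close> and \<open>g = -1\<close> select the two sides of
  the locus where the \<open>j\<close>-th point is \<open>w\<close>, and \<open>g = 0\<close> imposes no such restriction.\<close>

definition near_chart :: "'i set \<Rightarrow> 'i \<Rightarrow> real \<Rightarrow> ('i \<Rightarrow> real) set" where
  "near_chart I j g =
     {y \<in> no_three_equal (I - {j}). (\<forall>i\<in>I - {j}. \<bar>y j\<bar> * \<bar>y i\<bar> < 1) \<and> (g = 0 \<or> 0 < g * y j)}"

text \<open>For fixed other coordinates the admissible values of the \<open>j\<close>-th one form an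
  interval, so this coordinate can be freed up to homotopy, which leaves the points indexed by
  \<open>I - {j}\<close>.\<close>

lemma has_euler_near_chart:
  fixes I :: "'i set"
  assumes "finite I" "g \<in> {0, 1, -1}"
  shows "has_euler (top_of_set (near_chart I j g)) (euler_line (card (I - {j})))"
proof (rule has_euler_homotopy_equivalent[OF homotopy_equivalent_straight_line has_euler_no_three_equal])
  let ?J = "I - {j}"
  \<comment> \<open>The denominator exceeds every \<bar>y i\<bar>, so the new coordinate satisfies
    the product bounds; its sign is that of \<open>g\<close>, and for \<open>g = 0\<close> it is 0,
    the parameter of \<open>w\<close>.\<close>
  define r where "r = (\<lambda>y::'i \<Rightarrow> real. y(j := g / (1 + (\<Sum>i\<in>?J. \<bar>y i\<bar>))))"
  have pos: "0 < 1 + (\<Sum>i\<in>?J. \<bar>y i\<bar>)" for y :: "'i \<Rightarrow> real"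
    by (intro add_pos_nonneg sum_nonneg) auto
  have rj: "\<bar>r y j\<bar> * \<bar>y i\<bar> < 1" if "i \<in> ?J" for y i
  proof -
    have "\<bar>y i\<bar> \<le> (\<Sum>i\<in>?J. \<bar>y i\<bar>)"
      using that assms(1) by (intro member_le_sum) auto
    moreover have "\<bar>r y j\<bar> \<le> 1 / (1 + (\<Sum>i\<in>?J. \<bar>y i\<bar>))"
      using assms(2) pos[of y] by (auto simp: r_def)
    ultimately have "\<bar>r y j\<bar> * \<bar>y i\<bar> \<le> 1 / (1 + (\<Sum>i\<in>?J. \<bar>y i\<bar>)) * (\<Sum>i\<in>?J. \<bar>y i\<bar>)"
      by (intro mult_mono) (auto intro!: divide_nonneg_pos pos)
    also have "\<dots> < 1" using pos[of y] by (simp add: field_simps)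
    finally show ?thesis .
  qed
  have rg: "g = 0 \<or> 0 < g * r y j" for y
    using assms(2) pos[of y] by (auto simp: r_def)
  have rn: "r y i = y i" if "i \<noteq> j" for y i using that by (simp add: r_def)
  show "finite ?J" using assms(1) by simp
  show "near_chart I j g \<subseteq> no_three_equal ?J" by (auto simp: near_chart_def)
  have c: "continuous_on (no_three_equal ?J) (\<lambda>y. y i)" for i
    by (rule continuous_on_subset[OF continuous_on_product_coordinates]) simp
  show "continuous_on (no_three_equal ?J) (\<lambda>y. r y i)" for i
  proof (cases "i = j")
    case True
    then show ?thesis using pos
      by (auto simp: r_def intro!: continuous_intros c less_imp_neq[symmetric])
  qed (simp add: r_def c)
  show "r y \<in> near_chart I j g" if "y \<in> no_three_equal ?J" for y
    using that rj[of _ y] rg[of y] no_three_equal_cong[of ?J "r y" y] by (auto simp: near_chart_def rn)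
  fix t :: real assume t: "0 \<le> t" "t \<le> 1"
  have eq: "(1 - t) * r y k + t * y k = y k" if "k \<noteq> j" for y k
    using that by (simp add: rn algebra_simps)
  have T: "(\<lambda>i. (1 - t) * r y i + t * y i) \<in> no_three_equal ?J" if "y \<in> no_three_equal ?J" for y
    using that no_three_equal_cong[of ?J "\<lambda>i. (1 - t) * r y i + t * y i" y] by (simp add: eq)
  then show "(\<lambda>i. (1 - t) * r y i + t * y i) \<in> no_three_equal ?J" if "y \<in> no_three_equal ?J" for y
    using that .
  fix y assume y: "y \<in> near_chart I j g"
  have "\<bar>(1 - t) * r y j + t * y j\<bar> * \<bar>y i\<bar> < 1" if "i \<in> ?J" for i
  proof -
    have "\<bar>(1 - t) * r y j + t * y j\<bar> \<le> (1 - t) * \<bar>r y j\<bar> + t * \<bar>y j\<bar>"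
      using t abs_triangle_ineq[of "(1 - t) * r y j" "t * y j"] by (simp add: abs_mult)
    then have "\<bar>(1 - t) * r y j + t * y j\<bar> * \<bar>y i\<bar> \<le> ((1 - t) * \<bar>r y j\<bar> + t * \<bar>y j\<bar>) * \<bar>y i\<bar>"
      by (rule mult_right_mono) simp
    also have "\<dots> = (1 - t) * (\<bar>r y j\<bar> * \<bar>y i\<bar>) + t * (\<bar>y j\<bar> * \<bar>y i\<bar>)"
      by (simp add: algebra_simps)
    also have "\<dots> < 1"
      using rj[OF that, of y] y that t by (intro convex_bound_lt) (auto simp: near_chart_def)
    finally show ?thesis .
  qed
  moreover have "g = 0 \<or> 0 < g * ((1 - t) * r y j + t * y j)"
  proof (cases "g = 0")
    case False
    then have "0 < g * r y j" "0 < g * y j" using rg[of y] y by (auto simp: near_chart_def)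
    then have "(1 - t) * (- (g * r y j)) + t * (- (g * y j)) < 0"
      using t by (intro convex_bound_lt) auto
    then show ?thesis by (simp add: algebra_simps)
  qed simp
  ultimately show "(\<lambda>i. (1 - t) * r y i + t * y i) \<in> near_chart I j g"
    using y T[of y] by (auto simp: near_chart_def eq)
qed

definition near_block :: "nat \<Rightarrow> complex \<Rightarrow> nat \<Rightarrow> real \<Rightarrow> (nat \<Rightarrow> complex) set" where
  "near_block n w j g = {x \<in> topspace (no_three_equal_space n w). x j \<noteq> - w \<and>
     (\<forall>i\<in>{1..<n} - {j}. dist (x j) w < dist (x i) w) \<and> (g = 0 \<or> 0 < g * Im (w / x j))}"

definition away_block :: "nat \<Rightarrow> complex \<Rightarrow> (nat \<Rightarrow> complex) set" where
  "away_block n w = {x \<in> topspace (no_three_equal_space n w). \<forall>i\<in>{1..<n}. x i \<noteq> w}"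

lemma subtopology_no_three_equal_space:
  assumes "S \<subseteq> topspace (no_three_equal_space n w)"
  shows "subtopology (no_three_equal_space n w) S = subtopology (product_topology (\<lambda>_. circle) {1..<n}) S"
proof -
  have "S \<subseteq> topspace (torus n) - \<Union>{triple_coincidence n w i j k | i j k. 1 \<le> i \<and> i < j \<and> j < k \<and> k \<le> n}"
    using assms by (simp add: no_three_equal_space_def)
  then show ?thesis
    unfolding no_three_equal_space_def subtopology_subtopology torus_def by (simp only: Int_absorb1)
qed

text \<open>With \<open>w\<close> avoided, one Cayley chart serves for all coordinates and only
  coincidences among the free points remain.\<close>

lemma has_euler_away_block:
  assumes w: "norm w = 1"
  shows "has_euler (subtopology (no_three_equal_space n w) (away_block n w)) (euler_line (n - 1))"
proof -
  have mem: "(\<lambda>i\<in>{1..<n}. cayley w (y i)) \<in> away_block n w \<longleftrightarrow> y \<in> no_three_equal {1..<n}" for y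
    by (auto simp: away_block_def mem_topspace_no_three_equal_space no_three_equal_def
        cayley_eq_iff[OF w] cayley_neq[OF w] norm_cayley[OF w])
  have "has_euler (subtopology (product_topology (\<lambda>_. circle) {1..<n}) (away_block n w)) (euler_line (n - 1))"
  proof (rule has_euler_charts[where \<phi> = "\<lambda>_. cayley w" and \<psi> = "\<lambda>_. cayley_inv w"])
    show "away_block n w \<subseteq> (\<Pi>\<^sub>E i\<in>{1..<n}. range (cayley w))"
      unfolding range_cayley[OF w]
      by (rule subsetI) (simp add: away_block_def mem_topspace_no_three_equal_space PiE_iff)
    show "has_euler (top_of_set {y. (\<lambda>i\<in>{1..<n}. cayley w (y i)) \<in> away_block n w}) (euler_line (n - 1))"
      unfolding mem Collect_mem_eq using has_euler_no_three_equal[of "{1..<n}"] by simp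
  qed (use w in \<open>auto intro: continuous_map_cayley continuous_map_cayley_inv simp: cayley_inv_cayley\<close>)
  then show ?thesis
    by (subst subtopology_no_three_equal_space) (auto simp: away_block_def)
qed

lemma has_euler_near_block:
  assumes w: "norm w = 1" and j: "j \<in> {1..<n}" and g: "g \<in> {0, 1, -1}"
  shows "has_euler (subtopology (no_three_equal_space n w) (near_block n w j g)) (euler_line (n - 2))"
proof -
  define I where "I = {1..<n}"
  have w': "norm (- w) = 1" using w by simp
  \<comment> \<open>The \<open>j\<close>-th point is charted around \<open>w\<close>, by the chart
    that omits \<open>- w\<close>; all others use the chart that omits \<open>w\<close>.\<close>
  define v where "v = (\<lambda>i. if i = j then - w else w)"
  have nv: "norm (v i) = 1" for i using w by (simp add: v_def)
  have vn: "v i = w" if "i \<noteq> j" for i using that by (simp add: v_def)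
  have vj: "v j = - w" by (simp add: v_def)
  have mem: "(\<lambda>i\<in>I. cayley (v i) (y i)) \<in> near_block n w j g \<longleftrightarrow> y \<in> near_chart I j g" for y
  proof -
    define x where "x = (\<lambda>i\<in>I. cayley (v i) (y i))"
    have xi: "x i = cayley w (y i)" if "i \<in> I - {j}" for i using that by (simp add: x_def vn)
    have xj: "x j = cayley (- w) (y j)" using j by (simp add: x_def vj I_def)
    have 1: "dist (x j) w < dist (x i) w \<longleftrightarrow> \<bar>y j\<bar> * \<bar>y i\<bar> < 1" if "i \<in> I - {j}" for i
      unfolding xi[OF that] xj by (rule dist_cayley_less_iff[OF w])
    have "0 < (y j)\<^sup>2 + 1" by (simp add: add_nonneg_pos)
    then have 2: "0 < g * Im (w / x j) \<longleftrightarrow> 0 < g * y j"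
      unfolding xj Im_divide_cayley_uminus[OF w] by (simp add: zero_less_divide_iff zero_less_mult_iff not_less[symmetric])
    \<comment> \<open>Being strictly nearest to \<open>w\<close>, the \<open>j\<close>-th point
      meets no other free point and no other free point is at \<open>w\<close>; so triples involving
      \<open>j\<close> or the fixed point cannot coincide.\<close>
    have 3: "x \<in> topspace (no_three_equal_space n w)"
      if less: "\<And>i. i \<in> I - {j} \<Longrightarrow> dist (x j) w < dist (x i) w" and y: "y \<in> no_three_equal (I - {j})"
      unfolding mem_topspace_no_three_equal_space I_def[symmetric]
    proof (intro conjI ballI impI)
      show "x \<in> (\<Pi>\<^sub>E i\<in>I. sphere 0 1)" using norm_cayley[OF nv] by (auto simp: x_def)
    next
      fix i k assume ik: "i \<in> I" "k \<in> I" "x i = w \<and> x k = w"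
      have "i = j" if "i \<in> I" "x i = w" for i
      proof (rule ccontr)
        assume "i \<noteq> j" then show False using that xi[of i] cayley_neq[OF w] by auto
      qed
      then show "i = k" using ik by blast
    next
      fix i k l assume *: "i \<in> I" "k \<in> I" "l \<in> I" "x i = x k \<and> x k = x l"
      have nj: "x m \<noteq> x j" if "m \<in> I - {j}" for m using less[OF that] by auto
      show "i = k \<or> k = l \<or> i = l"
      proof (cases "j \<in> {i, k, l}")
        case True
        then show ?thesis using nj * by auto
      next
        case False
        then have "y i = y k \<and> y k = y l" "i \<in> I - {j}" "k \<in> I - {j}" "l \<in> I - {j}"
          using * xi[of i] xi[of k] xi[of l] by (auto simp: cayley_eq_iff[OF w])
        then show ?thesis using y unfolding no_three_equal_def by blast
      qed
    qed
    have 4: "y \<in> no_three_equal (I - {j})" if "x \<in> topspace (no_three_equal_space n w)"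
    proof -
      have "\<forall>i\<in>I. \<forall>j\<in>I. \<forall>k\<in>I. x i = x j \<and> x j = x k \<longrightarrow> i = j \<or> j = k \<or> i = k"
        using that unfolding mem_topspace_no_three_equal_space I_def by blast
      then show ?thesis
        unfolding no_three_equal_def using xi by (auto simp: cayley_eq_iff[OF w])
    qed
    have "x j \<noteq> - w" unfolding xj by (rule cayley_neq[OF w'])
    then show ?thesis
      unfolding x_def[symmetric] near_block_def near_chart_def I_def[symmetric] using 1 2 3 4 by blast
  qed
  have "has_euler (subtopology (product_topology (\<lambda>_. circle) I) (near_block n w j g)) (euler_line (n - 2))"
  proof (rule has_euler_charts[where \<phi> = "\<lambda>i. cayley (v i)" and \<psi> = "\<lambda>i. cayley_inv (v i)"])
    show "near_block n w j g \<subseteq> (\<Pi>\<^sub>E i\<in>I. range (cayley (v i)))"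
    proof
      fix x assume x: "x \<in> near_block n w j g"
      \<comment> \<open>For \<open>i = j\<close> the omitted point is excluded explicitly in
        \<open>near_block\<close>, which matters when \<open>n = 2\<close> and there are no
        distances to compare. Any other point has positive distance to \<open>w\<close>.\<close>
      have "x i \<noteq> v i" if "i \<in> I" for i
      proof (cases "i = j")
        case True
        then show ?thesis using x by (simp add: near_block_def vj)
      next
        case False
        then have "dist (x j) w < dist (x i) w" using x that by (simp add: near_block_def I_def)
        then show ?thesis using False by (auto simp: vn)
      qed
      then show "x \<in> (\<Pi>\<^sub>E i\<in>I. range (cayley (v i)))"
        using x unfolding range_cayley[OF nv]
        by (simp add: near_block_def mem_topspace_no_three_equal_space PiE_iff I_def)
    qed
    have "card (I - {j}) = n - 2" using j by (simp add: I_def)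
    then show "has_euler (top_of_set {y. (\<lambda>i\<in>I. cayley (v i) (y i)) \<in> near_block n w j g}) (euler_line (n - 2))"
      unfolding mem Collect_mem_eq using has_euler_near_chart[OF _ g, of I j] by (simp add: I_def)
  qed (use nv in \<open>auto intro: continuous_map_cayley continuous_map_cayley_inv simp: cayley_inv_cayley\<close>)
  then show ?thesis
    unfolding I_def by (subst subtopology_no_three_equal_space) (auto simp: near_block_def)
qed

section \<open>Openness of the blocks on the circle\<close>

lemma openin_Collect_ball_pos:
  assumes "finite J" "\<And>i. i \<in> J \<Longrightarrow> continuous_map X euclideanreal (f i)"
  shows "openin X {x \<in> topspace X. \<forall>i\<in>J. 0 < f i x}"
  using assms
proof (induct J rule: finite_induct)
  case (insert i J)
  have "openin X {x \<in> topspace X. f i x \<in> {0<..}}"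
    using insert by (intro openin_continuous_map_preimage[of X euclideanreal]) auto
  then have "openin X ({x \<in> topspace X. f i x \<in> {0<..}} \<inter> {x \<in> topspace X. \<forall>i\<in>J. 0 < f i x})"
    using insert by (intro openin_Int) auto
  then show ?case by (rule back_subst) auto
qed simp

lemma continuous_map_no_three_equal_space:
  assumes "i \<in> {1..<n}" "continuous_on (sphere 0 1) h"
  shows "continuous_map (no_three_equal_space n w) euclideanreal (\<lambda>x. h (x i))"
proof -
  have "continuous_map (no_three_equal_space n w) circle (\<lambda>x. x i)"
    unfolding no_three_equal_space_def torus_def using assms(1)
    by (intro continuous_map_from_subtopology continuous_map_product_projection)
  moreover have "continuous_map circle euclideanreal h" using assms(2) by (simp add: circle_def)
  ultimately show ?thesis
    using continuous_map_compose by (fastforce simp: o_def)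
qed

lemma openin_away_block: "openin (no_three_equal_space n w) (away_block n w)"
proof -
  have "openin (no_three_equal_space n w)
      {x \<in> topspace (no_three_equal_space n w). \<forall>i\<in>{1..<n}. 0 < dist (x i) w}"
    by (intro openin_Collect_ball_pos continuous_map_no_three_equal_space) (auto intro!: continuous_intros)
  then show ?thesis by (simp add: away_block_def)
qed

lemma openin_near_block:
  assumes "j \<in> {1..<n}"
  shows "openin (no_three_equal_space n w) (near_block n w j g)"
proof -
  let ?X = "no_three_equal_space n w"
  have c: "continuous_map ?X euclideanreal (\<lambda>x. dist (x i) z)" if "i \<in> {1..<n}" for i z
    using that by (intro continuous_map_no_three_equal_space) (auto intro!: continuous_intros)
  have "openin ?X {x \<in> topspace ?X. \<forall>i\<in>{1..<n} - {j}. 0 < dist (x i) w - dist (x j) w}"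
    using assms by (intro openin_Collect_ball_pos continuous_map_diff c) auto
  \<comment> \<open>A one-element index set brings a single inequality into the form of
    \<open>openin_Collect_ball_pos\<close>.\<close>
  moreover have "openin ?X {x \<in> topspace ?X. \<forall>_\<in>{()}. 0 < dist (x j) (- w)}"
    using assms by (intro openin_Collect_ball_pos c) auto
  moreover have "openin ?X {x \<in> topspace ?X. \<forall>_\<in>{()}. 0 < g * Im (w / x j)}"
    using assms by (intro openin_Collect_ball_pos continuous_map_no_three_equal_space)
      (auto intro!: continuous_intros)
  then have "openin ?X {x \<in> topspace ?X. g = 0 \<or> 0 < g * Im (w / x j)}" by (cases "g = 0") auto
  ultimately have "openin ?X ({x \<in> topspace ?X. \<forall>i\<in>{1..<n} - {j}. 0 < dist (x i) w - dist (x j) w} \<inter>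
     {x \<in> topspace ?X. \<forall>_\<in>{()}. 0 < dist (x j) (- w)} \<inter> {x \<in> topspace ?X. g = 0 \<or> 0 < g * Im (w / x j)})"
    by (intro openin_Int)
  then show ?thesis by (rule back_subst) (auto simp: near_block_def)
qed

lemma has_euler_no_three_equal_space:
  assumes w: "norm w = 1"
  shows "has_euler (no_three_equal_space n w) (euler_line (n - 1) - int (n - 1) * euler_line (n - 2))"
proof -
  let ?X = "no_three_equal_space n w"
  let ?I = "{1..<n}"
  define A where "A = away_block n w"
  define B where "B = (\<lambda>j. near_block n w j 0)"
  define C where "C = (\<lambda>(j, g). near_block n w j g)"
  \<comment> \<open>The second component is the side of \<open>w\<close> on which the nearest point
    lies.\<close>
  define P where "P = ?I \<times> {1, -1 :: real}"
  have disj: "near_block n w j g \<inter> near_block n w k h = {}" if "j \<in> ?I" "k \<in> ?I" "j \<noteq> k" for j k g h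
  proof -
    have "dist (x j) w < dist (x k) w \<and> dist (x k) w < dist (x j) w"
      if "x \<in> near_block n w j g \<inter> near_block n w k h" for x
      using that \<open>j \<in> ?I\<close> \<open>k \<in> ?I\<close> \<open>j \<noteq> k\<close> by (simp add: near_block_def)
    then show ?thesis by (meson equals0I less_asym)
  qed
  have "has_euler (subtopology ?X A) (euler_line (n - 1))" "openin ?X A"
    unfolding A_def by (rule has_euler_away_block[OF w] openin_away_block)+
  moreover have "has_euler (subtopology ?X (\<Union>j\<in>?I. B j)) (int (card ?I) * euler_line (n - 2))"
    unfolding B_def
    by (rule has_euler_disjoint_UN) (use disj has_euler_near_block[OF w] openin_near_block in auto)
  moreover have "has_euler (subtopology ?X (\<Union>p\<in>P. C p)) (int (card P) * euler_line (n - 2))"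
  proof (rule has_euler_disjoint_UN)
    fix p q assume pq: "p \<in> P" "q \<in> P" "p \<noteq> q"
    obtain j g k h where [simp]: "p = (j, g)" "q = (k, h)" by (metis surj_pair)
    show "C p \<inter> C q = {}"
    proof (cases "j = k")
      case True
      then have "g = - h" "h \<noteq> 0" using pq by (auto simp: P_def)
      then show ?thesis by (auto simp: C_def near_block_def True zero_less_mult_iff)
    next
      case False
      then show ?thesis using disj pq by (auto simp: C_def P_def)
    qed
  qed (use has_euler_near_block[OF w] openin_near_block in \<open>auto simp: C_def P_def\<close>)
  moreover have "openin ?X (\<Union>j\<in>?I. B j)"
    unfolding B_def by (intro openin_Union) (auto intro: openin_near_block)
  moreover have "A \<inter> (\<Union>j\<in>?I. B j) = (\<Union>p\<in>P. C p)"
  proof (intro equalityI subsetI)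
    fix x assume "x \<in> A \<inter> (\<Union>j\<in>?I. B j)"
    then obtain j where j: "j \<in> ?I" "x \<in> A" "x \<in> B j" by blast
    \<comment> \<open>\<open>u\<close> lies on the unit circle and is neither 1 nor -1, so its
      imaginary part is nonzero and its sign selects the side.\<close>
    define u where "u = w / x j"
    have nx: "norm (x j) = 1" "x j \<noteq> w" "x j \<noteq> - w"
      using j by (auto simp: A_def B_def away_block_def near_block_def mem_topspace_no_three_equal_space PiE_iff)
    have "w = u * x j" using nx(1) by (auto simp: u_def)
    then have "u \<noteq> 1" "u \<noteq> -1" using nx(2,3) by auto
    have "norm u = 1" using nx(1) w by (simp add: u_def norm_divide)
    have "Im u \<noteq> 0"
    proof
      assume "Im u = 0"
      then have "u = of_real (Re u)" by (simp add: complex_eq_iff)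
      then have "\<bar>Re u\<bar> = 1" using \<open>norm u = 1\<close> by (metis norm_of_real)
      then show False using \<open>u = of_real (Re u)\<close> \<open>u \<noteq> 1\<close> \<open>u \<noteq> -1\<close>
        by (metis abs_eq_iff' abs_one of_real_1 of_real_minus)
    qed
    then have "0 < sgn (Im u) * Im u" "sgn (Im u) \<in> {1, -1}"
      by (auto simp: sgn_if)
    then have "x \<in> C (j, sgn (Im u))" "(j, sgn (Im u)) \<in> P"
      using j by (auto simp: B_def C_def near_block_def u_def P_def)
    then show "x \<in> (\<Union>p\<in>P. C p)" by blast
  next
    fix x assume "x \<in> (\<Union>p\<in>P. C p)"
    then obtain j g where "(j, g) \<in> P" "x \<in> C (j, g)" by auto
    then have jg: "j \<in> ?I" "g \<noteq> 0" "x \<in> near_block n w j g" by (auto simp: P_def C_def)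
    have "x i \<noteq> w" if "i \<in> ?I" for i
    proof (cases "i = j")
      case True
      have "w \<noteq> 0" using w by auto
      moreover have "0 < g * Im (w / x j)" using jg by (auto simp: near_block_def)
      ultimately show ?thesis using True by auto
    next
      case False
      then have "dist (x j) w < dist (x i) w" using jg(3) that by (simp add: near_block_def)
      then show ?thesis by auto
    qed
    then have "x \<in> A" "x \<in> B j" using jg by (auto simp: A_def B_def away_block_def near_block_def)
    with jg show "x \<in> A \<inter> (\<Union>j\<in>?I. B j)" by blast
  qed
  moreover have "A \<union> (\<Union>j\<in>?I. B j) = topspace ?X"
  proof (intro equalityI subsetI)
    fix x assume x: "x \<in> topspace ?X"
    show "x \<in> A \<union> (\<Union>j\<in>?I. B j)"
    proof (cases "x \<in> A")
      case False
      then obtain j where j: "j \<in> ?I" "x j = w" using x by (auto simp: A_def away_block_def)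
      \<comment> \<open>At most one free point lies at \<open>w\<close>, so the \<open>j\<close>-th
        point, at distance 0, is strictly nearest.\<close>
      have "x i \<noteq> w" if "i \<in> ?I - {j}" for i
        using x j that unfolding mem_topspace_no_three_equal_space by blast
      moreover have "w \<noteq> - w" using w by auto
      ultimately have "x \<in> B j" using x j by (auto simp: B_def near_block_def)
      then show ?thesis using j by blast
    qed simp
  qed (auto simp: A_def B_def away_block_def near_block_def)
  ultimately have "has_euler (subtopology ?X (topspace ?X))
      (euler_line (n - 1) + int (card ?I) * euler_line (n - 2) - int (card P) * euler_line (n - 2))"
    using has_euler_open_Un[of ?X A "\<Union>j\<in>?I. B j"] by simp
  \<comment> \<open>The two sides give twice \<open>n - 1\<close> overlaps against
    \<open>n - 1\<close> near blocks, hence the coefficient \<open>- (n - 1)\<close>.\<close>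
  moreover have "int (card P) = 2 * int (n - 1)" by (simp add: P_def card_cartesian_product)
  ultimately show ?thesis by (simp add: algebra_simps)
qed

theorem theorem4:
  fixes n :: nat and w :: complex
  assumes "n \<ge> 1" and "w \<in> sphere 0 1"
  shows "finite_betti (no_three_equal_space n w) \<and>
         real_of_int (euler_characteristic (no_three_equal_space n w)) =
           fact (n - 1) * 2 powr (1 - real n / 2) * cos (pi * real n / 4)"
  using has_euler_no_three_equal_space[of w n] euler_circle_closed_form[OF assms(1)] assms(2)
  by (simp add: has_euler_def)

end
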